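(* Let $(W,S)$ be a finite Coxeter system, $Q=q_1\cdots q_m$ a word on $S$, and $\rho\in W$ such that the subword complex $\mathcal{SC}(Q,\rho)$ is double root free. Then the Möbius function of the increasing flip poset $\Gamma(Q,\rho)$ is given, for facets $I,J$ of $\mathcal{SC}(Q,\rho)$, by $$\mu(I,J)=\begin{cases}(-1)^{|J\setminus I|} & \text{if there is a } \mathsf p\text{-falling (resp. } \mathsf n\text{-falling) path from } I \text{ to } J,\\ 0&\text{otherwise.}\end{cases}$$
   Context: Let $(W,S)$ be a finite Coxeter system acting by reflections on a Euclidean space $V$, with length function $\ell$, root system $\Phi$ and simple roots $\{\alpha_s: s\in S\}$. Let $Q=q_1q_2\cdots q_m$ be a word in the letters $S$ and $\rho\in W$; write $[m]=\{1,\dots,m\}$. The subword complex $\mathcal{SC}(Q,\rho)$ is the simplicial complex whose facets are the sets $I\subseteq[m]$ such that the letters of $Q$ at the positions in $[m]\setminus I$, read in increasing order of position, form a reduced expression of $\rho$. The root function of a facet $I$ is $\mathsf r(I,k)=w(\alpha_{q_k})\in\Phi$ for $k\in[m]$, where $w$ is the product of the $q_x$, $x\in[k-1]\setminus I$, in increasing order of position. Two distinct facets $I,J$ are adjacent if $I\setminus\{i\}=J\setminus\{j\}$ for some $i\in I$, $j\in J$; then $i$ is called flippable in $I$. The flip from $I$ to $J$ is increasing if $i<j$. The increasing flip graph $\mathcal G(Q,\rho)$ is the acyclic directed graph whose vertices are the facets and whose edges $I\to J$ are the increasing flips. For an edge $I\to J$ with $I\setminus\{i\}=J\setminus\{j\}$,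 $i<j$, set $\mathsf p(I\to J)=i$ and $\mathsf n(I\to J)=j$. A path in $\mathcal G(Q,\rho)$ (possibly of length $0$) is $\mathsf p$-falling (resp. $\mathsf n$-falling) if the sequence of $\mathsf p$-labels (resp. $\mathsf n$-labels) of its successive edges is weakly decreasing; the formula holds with either choice of labeling. The increasing flip poset $\Gamma(Q,\rho)$ is the set of facets with $I\le J$ if there is a directed path from $I$ to $J$ in $\mathcal G(Q,\rho)$. The Möbius function of a finite poset is defined by $\mu(u,u)=1$, $\mu(u,v)=-\sum_{u\le w<v}\mu(u,w)$ if $u<v$, and $\mu(u,v)=0$ otherwise. The subword complex has a double root if there is a facet $I$ and two distinct positions $i\neq j$, both flippable in $I$, with $\mathsf r(I,i)=\mathsf r(I,j)$; otherwise it is double root free. *)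

theory Defs
  imports
    "HOL-Analysis.Analysis"
    "HOL-Algebra.Generated_Groups"
    "HOL-Algebra.Multiplicative_Group"
begin

section \<open>Coxeter systems\<close>

definition word_prod :: "('g, 'b) monoid_scheme \<Rightarrow> 'g list \<Rightarrow> 'g" where
  "word_prod W w = foldr (mult W) w (one W)"

text \<open>
  Two words over \<open>S\<close> are equivalent if they are related by insertions and deletions of the
  Coxeter relators \<open>(s t)^{m(s,t)}\<close>, where \<open>m(s,t)\<close> is the order of \<open>s t\<close>. For \<open>s = t\<close> the relator
  is \<open>s s\<close>, so formal inverses are not needed and the quotient of the word monoid is the group
  presented by the Coxeter relations. The library order is \<open>0\<close> for elements of infinite
  order, and the relator is then the empty word.
\<close>

inductive coxeter_equiv :: "('g, 'b) monoid_scheme \<Rightarrow> 'g set \<Rightarrow> 'g list \<Rightarrow> 'g list \<Rightarrow> bool"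
  for W S where
  relator: "\<lbrakk>u \<in> lists S; v \<in> lists S; s \<in> S; t \<in> S\<rbrakk> \<Longrightarrow>
     coxeter_equiv W S (u @ concat (replicate (group.ord W (s \<otimes>\<^bsub>W\<^esub> t)) [s, t]) @ v) (u @ v)"
| refl: "u \<in> lists S \<Longrightarrow> coxeter_equiv W S u u"
| sym: "coxeter_equiv W S u v \<Longrightarrow> coxeter_equiv W S v u"
| trans: "\<lbrakk>coxeter_equiv W S u v; coxeter_equiv W S v w\<rbrakk> \<Longrightarrow> coxeter_equiv W S u w"

locale coxeter_system = group W for W :: "('g, 'b) monoid_scheme" (structure) +
  fixes S :: "'g set"
  assumes S_carrier: "S \<subseteq> carrier W"
    and S_order: "s \<in> S \<Longrightarrow> ord s = 2"
    and S_generates: "generate W S = carrier W"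
    and presentation: "\<lbrakk>u \<in> lists S; v \<in> lists S\<rbrakk> \<Longrightarrow>
      word_prod W u = word_prod W v \<longleftrightarrow> coxeter_equiv W S u v"

definition cox_length :: "('g, 'b) monoid_scheme \<Rightarrow> 'g set \<Rightarrow> 'g \<Rightarrow> nat" where
  "cox_length W S g = (LEAST n. \<exists>w \<in> lists S. length w = n \<and> word_prod W w = g)"

definition reduced_expression :: "('g, 'b) monoid_scheme \<Rightarrow> 'g set \<Rightarrow> 'g list \<Rightarrow> 'g \<Rightarrow> bool" where
  "reduced_expression W S w g \<longleftrightarrow>
     w \<in> lists S \<and> word_prod W w = g \<and> length w = cox_length W S g"

section \<open>Root systems\<close>

definition reflection_along :: "'v::euclidean_space \<Rightarrow> 'v \<Rightarrow> 'v" where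
  "reflection_along v x = x - (2 * (x \<bullet> v) / (v \<bullet> v)) *\<^sub>R v"

text \<open>
  The vectors orthogonal to the reflecting hyperplanes of \<open>W\<close>, where \<open>W\<close> acts through \<open>act\<close>.
\<close>

definition reflecting_vectors ::
  "('g, 'b) monoid_scheme \<Rightarrow> ('g \<Rightarrow> 'v::euclidean_space \<Rightarrow> 'v) \<Rightarrow> 'v set" where
  "reflecting_vectors W act = {v. v \<noteq> 0 \<and> (\<exists>g \<in> carrier W. act g = reflection_along v)}"

text \<open>
  A finite Coxeter system acting faithfully by orthogonal transformations on a Euclidean space,
  each \<open>s \<in> S\<close> acting as the reflection in its simple root \<open>\<alpha> s\<close>. The root system \<open>\<Phi>\<close> is
  \<open>W\<close>-invariant and consists of exactly two opposite vectors on each line orthogonal to a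
  reflecting hyperplane; roots need not have unit length, and the roots need not span.
\<close>

locale finite_coxeter_system = coxeter_system W S
  for W :: "('g, 'b) monoid_scheme" (structure) and S :: "'g set" +
  fixes act :: "'g \<Rightarrow> 'v::euclidean_space \<Rightarrow> 'v"
    and \<Phi> :: "'v set"
    and \<alpha> :: "'g \<Rightarrow> 'v"
  assumes finite_carrier: "finite (carrier W)"
    and act_orthogonal: "g \<in> carrier W \<Longrightarrow> orthogonal_transformation (act g)"
    and act_one: "act \<one> = id"
    and act_mult: "\<lbrakk>g \<in> carrier W; h \<in> carrier W\<rbrakk> \<Longrightarrow> act (g \<otimes> h) = act g \<circ> act h"
    and act_faithful: "inj_on act (carrier W)"
    and act_simple: "s \<in> S \<Longrightarrow> act s = reflection_along (\<alpha> s)"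
    and roots_reflecting: "\<Phi> \<subseteq> reflecting_vectors W act"
    and roots_opposite: "v \<in> reflecting_vectors W act \<Longrightarrow> \<exists>\<beta>. \<Phi> \<inter> span {v} = {\<beta>, - \<beta>}"
    and roots_invariant: "g \<in> carrier W \<Longrightarrow> act g ` \<Phi> \<subseteq> \<Phi>"
    and simple_roots: "\<alpha> ` S \<subseteq> \<Phi>"
    and simple_independent: "independent (\<alpha> ` S)"
    and simple_signs: "\<beta> \<in> \<Phi> \<Longrightarrow>
      \<exists>c. (\<forall>s \<in> S. c s \<ge> 0) \<and>
          (\<beta> = (\<Sum>s \<in> S. c s *\<^sub>R \<alpha> s) \<or> \<beta> = - (\<Sum>s \<in> S. c s *\<^sub>R \<alpha> s))"

section \<open>Subword complexes\<close>

text \<open>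
  Positions in the word \<open>Q\<close> are counted from \<open>0\<close>, and \<open>nths Q A\<close> is the subword of \<open>Q\<close> at the
  positions in \<open>A\<close>.
\<close>

definition facets :: "('g, 'b) monoid_scheme \<Rightarrow> 'g set \<Rightarrow> 'g list \<Rightarrow> 'g \<Rightarrow> nat set set" where
  "facets W S Q \<rho> =
     {I. I \<subseteq> {..<length Q} \<and> reduced_expression W S (nths Q ({..<length Q} - I)) \<rho>}"

definition root_function ::
  "('g, 'b) monoid_scheme \<Rightarrow> ('g \<Rightarrow> 'v \<Rightarrow> 'v) \<Rightarrow> ('g \<Rightarrow> 'v) \<Rightarrow> 'g list \<Rightarrow> nat set \<Rightarrow> nat \<Rightarrow> 'v" where
  "root_function W act \<alpha> Q I k = act (word_prod W (nths Q ({..<k} - I))) (\<alpha> (Q ! k))"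

definition flippable ::
  "('g, 'b) monoid_scheme \<Rightarrow> 'g set \<Rightarrow> 'g list \<Rightarrow> 'g \<Rightarrow> nat set \<Rightarrow> nat \<Rightarrow> bool" where
  "flippable W S Q \<rho> I i \<longleftrightarrow>
     i \<in> I \<and> (\<exists>J \<in> facets W S Q \<rho>. J \<noteq> I \<and> (\<exists>j \<in> J. I - {i} = J - {j}))"

definition double_root_free ::
  "('g, 'b) monoid_scheme \<Rightarrow> 'g set \<Rightarrow> ('g \<Rightarrow> 'v \<Rightarrow> 'v) \<Rightarrow> ('g \<Rightarrow> 'v) \<Rightarrow> 'g list \<Rightarrow> 'g \<Rightarrow> bool" where
  "double_root_free W S act \<alpha> Q \<rho> \<longleftrightarrow>
     \<not> (\<exists>I \<in> facets W S Q \<rho>. \<exists>i j. i \<noteq> j \<and> flippable W S Q \<rho> I i \<and> flippable W S Q \<rho> I j \<and>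
          root_function W act \<alpha> Q I i = root_function W act \<alpha> Q I j)"

section \<open>Increasing flips\<close>

definition increasing_flip ::
  "('g, 'b) monoid_scheme \<Rightarrow> 'g set \<Rightarrow> 'g list \<Rightarrow> 'g \<Rightarrow> nat set \<Rightarrow> nat set \<Rightarrow> bool" where
  "increasing_flip W S Q \<rho> I J \<longleftrightarrow>
     I \<in> facets W S Q \<rho> \<and> J \<in> facets W S Q \<rho> \<and> I \<noteq> J \<and>
     (\<exists>i \<in> I. \<exists>j \<in> J. I - {i} = J - {j} \<and> i < j)"

text \<open>The labels are meaningful only for an edge \<open>I \<rightarrow> J\<close>, where the position is unique.\<close>

definition p_label :: "nat set \<Rightarrow> nat set \<Rightarrow> nat" where
  "p_label I J = (THE i. i \<in> I \<and> (\<exists>j \<in> J. I - {i} = J - {j}))"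

definition n_label :: "nat set \<Rightarrow> nat set \<Rightarrow> nat" where
  "n_label I J = (THE j. j \<in> J \<and> (\<exists>i \<in> I. I - {i} = J - {j}))"

text \<open>A path is given by the list of its vertices; a single vertex is a path of length \<open>0\<close>.\<close>

definition flip_path ::
  "('g, 'b) monoid_scheme \<Rightarrow> 'g set \<Rightarrow> 'g list \<Rightarrow> 'g \<Rightarrow>
     nat set \<Rightarrow> nat set \<Rightarrow> nat set list \<Rightarrow> bool" where
  "flip_path W S Q \<rho> I J xs \<longleftrightarrow>
     xs \<noteq> [] \<and> set xs \<subseteq> facets W S Q \<rho> \<and> hd xs = I \<and> last xs = J \<and>
     successively (increasing_flip W S Q \<rho>) xs"

definition falling :: "(nat set \<Rightarrow> nat set \<Rightarrow> nat) \<Rightarrow> nat set list \<Rightarrow> bool" where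
  "falling label xs \<longleftrightarrow> sorted_wrt (\<ge>) (map2 label (butlast xs) (tl xs))"

definition flip_order ::
  "('g, 'b) monoid_scheme \<Rightarrow> 'g set \<Rightarrow> 'g list \<Rightarrow> 'g \<Rightarrow> (nat set \<times> nat set) set" where
  "flip_order W S Q \<rho> = {(I, J). \<exists>xs. flip_path W S Q \<rho> I J xs}"

section \<open>The Moebius function of a finite poset\<close>

function poset_moebius :: "'a set \<Rightarrow> ('a \<times> 'a) set \<Rightarrow> 'a \<Rightarrow> 'a \<Rightarrow> int" where
  "poset_moebius P r u v =
     (if finite P \<and> partial_order_on P r \<and> (u, v) \<in> r then
        if u = v then 1
        else - (\<Sum>w \<in> {w \<in> P. (u, w) \<in> r \<and> (w, v) \<in> r \<and> w \<noteq> v}. poset_moebius P r u w)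
      else 0)"
  by pat_completeness auto
termination
proof (relation "Wellfounded.measure (\<lambda>(P, r, u, v). card {x \<in> P. (x, v) \<in> r})", goal_cases)
  case 1
  show ?case by simp
next
  case (2 P r u v w)
  then have fin: "finite P" and refl: "refl_on P r" and tr: "trans r" and anti: "antisym r"
    and sub: "r \<subseteq> P \<times> P"
    by (auto dest: partial_order_onD)
  have wv: "(w, v) \<in> r" "w \<noteq> v"
    using 2 by auto
  then have "(v, v) \<in> r" "v \<in> P"
    using refl sub by (auto simp: refl_on_def)
  moreover have "(v, w) \<notin> r"
    using wv anti by (auto dest: antisymD)
  ultimately have "{x \<in> P. (x, w) \<in> r} \<subset> {x \<in> P. (x, v) \<in> r}"
    using wv(1) tr by (auto dest: transD)
  then show ?case
    using fin by (auto intro!: psubset_card_mono)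
qed

declare poset_moebius.simps [simp del]

text \<open>The increasing flip poset is a finite poset, so the guard in \<open>poset_moebius\<close> is met.\<close>

lemma finite_facets: "finite (facets W S Q \<rho>)"
  by (rule finite_subset [of _ "Pow {..<length Q}"]) (auto simp: facets_def)

lemma increasing_flip_sum_less:
  assumes "increasing_flip W S Q \<rho> I J"
  shows "\<Sum>I < \<Sum>J"
proof -
  obtain i j where ij: "i \<in> I" "j \<in> J" "I - {i} = J - {j}" "i < j"
    and sub: "I \<subseteq> {..<length Q}" "J \<subseteq> {..<length Q}"
    using assms by (auto simp: increasing_flip_def facets_def)
  have fin: "finite I" "finite J"
    using sub by (auto intro: finite_subset)
  have "\<Sum>I = i + \<Sum>(I - {i})" "\<Sum>J = j + \<Sum>(J - {j})"
    using sum.remove [OF fin(1) ij(1), of "\<lambda>x. x"] sum.remove [OF fin(2) ij(2), of "\<lambda>x. x"]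
    by simp_all
  then show ?thesis
    using ij(3,4) by simp
qed

lemma flip_path_sum_le:
  "flip_path W S Q \<rho> I J xs \<Longrightarrow> I = J \<or> \<Sum>I < \<Sum>J"
proof (induction xs arbitrary: I)
  case Nil
  then show ?case by (simp add: flip_path_def)
next
  case (Cons x xs)
  show ?case
  proof (cases xs)
    case Nil
    then show ?thesis using Cons.prems by (auto simp: flip_path_def)
  next
    case (Cons y ys)
    then have "flip_path W S Q \<rho> y J xs" "increasing_flip W S Q \<rho> I y"
      using Cons.prems by (auto simp: flip_path_def)
    then show ?thesis
      using Cons.IH increasing_flip_sum_less by (metis less_trans)
  qed
qed

lemma flip_order_partial_order: "partial_order_on (facets W S Q \<rho>) (flip_order W S Q \<rho>)"
proof -
  have "flip_order W S Q \<rho> \<subseteq> facets W S Q \<rho> \<times> facets W S Q \<rho>"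
    by (auto simp: flip_order_def flip_path_def)
  moreover have "refl_on (facets W S Q \<rho>) (flip_order W S Q \<rho>)"
    by (auto simp: refl_on_def flip_order_def flip_path_def intro!: exI [of _ "[_]"])
  moreover have "antisym (flip_order W S Q \<rho>)"
    by (rule antisymI) (auto simp: flip_order_def dest!: flip_path_sum_le)
  moreover have "trans (flip_order W S Q \<rho>)"
  proof (rule transI)
    fix I J K
    assume "(I, J) \<in> flip_order W S Q \<rho>" "(J, K) \<in> flip_order W S Q \<rho>"
    then obtain xs ys where xs: "flip_path W S Q \<rho> I J xs" and ys: "flip_path W S Q \<rho> J K ys"
      by (auto simp: flip_order_def)
    have "flip_path W S Q \<rho> I K (xs @ tl ys)"
    proof (cases ys)
      case Nil
      then show ?thesis using ys by (simp add: flip_path_def)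
    next
      case (Cons y zs)
      then show ?thesis
        using xs ys by (cases zs) (auto simp: flip_path_def successively_append_iff)
    qed
    then show "(I, K) \<in> flip_order W S Q \<rho>"
      by (auto simp: flip_order_def)
  qed
  ultimately show ?thesis
    by (auto simp: partial_order_on_def preorder_on_def)
qed

end

theory Submission
  imports Defs
begin

text \<open>
  Along an edge \<open>I \<rightarrow> J\<close> the first position at which the two facets differ leaves the facet. Hence, if
  \<open>k\<close> is the first position distinguishing \<open>I < J\<close>, all facets in the interval \<open>[I, J]\<close> agree below \<open>k\<close>,
  and those containing \<open>k\<close> have the same root at \<open>k\<close>, which is an inversion of \<open>\<rho>\<close>. So \<open>k\<close> can be flipped in
  each of them. Without double roots this flip is injective, and a rank two argument shows that it is
  monotone, so that it matches the facets of \<open>[I, J]\<close> containing \<open>k\<close> with facets of \<open>[I, J]\<close> avoiding \<open>k\<close>. A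
  \<open>p\<close>-falling path from \<open>I\<close> to a facet avoiding \<open>k\<close> must end with a flip of \<open>k\<close>. The signs
  \<open>(-1)^|w - I|\<close> of the facets \<open>w\<close> reached by \<open>p\<close>-falling paths therefore cancel in pairs, which is the
  recursion of the Moebius function. The \<open>n\<close>-labels of \<open>Q\<close> and \<open>\<rho>\<close> are the \<open>p\<close>-labels of the reversed
  word and the inverse of \<open>\<rho>\<close>, whose flip poset is the opposite one; there the same cancellation
  gives the Moebius function as a left inverse of the zeta function.
\<close>

section \<open>Length and positive roots\<close>

lemma (in monoid) word_prod_simps [simp]:
  "word_prod G [] = \<one>"
  "word_prod G (x # w) = x \<otimes> word_prod G w"
  by (simp_all add: word_prod_def)

context coxeter_system
begin

lemma S_closed [simp, intro]: "s \<in> S \<Longrightarrow> s \<in> carrier W"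
  using S_carrier by auto

lemma word_prod_closed [simp, intro]: "w \<in> lists S \<Longrightarrow> word_prod W w \<in> carrier W"
  by (induction w) auto

lemma word_prod_append:
  "\<lbrakk>u \<in> lists S; v \<in> lists S\<rbrakk> \<Longrightarrow> word_prod W (u @ v) = word_prod W u \<otimes> word_prod W v"
  by (induction u) (auto simp: m_assoc)

lemma S_square: "s \<in> S \<Longrightarrow> s \<otimes> s = \<one>"
  using pow_ord_eq_1[of s] S_order[of s] by (auto simp: numeral_2_eq_2)

lemma S_inv: "s \<in> S \<Longrightarrow> inv s = s"
  by (simp add: S_square inv_equality)

lemma word_prod_rev:
  assumes "w \<in> lists S"
  shows "word_prod W (rev w) = inv (word_prod W w)"
  using assms
proof (induction w)
  case (Cons s w)
  then have "word_prod W (rev w @ [s]) = word_prod W (rev w) \<otimes> s"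
    by (subst word_prod_append) auto
  with Cons show ?case
    by (auto simp: inv_mult_group S_inv)
qed auto

lemma word_exists:
  assumes "g \<in> carrier W"
  obtains w where "w \<in> lists S" "word_prod W w = g"
proof -
  have "g \<in> generate W S"
    using assms S_generates by simp
  then have "\<exists>w \<in> lists S. word_prod W w = g"
  proof induction
    case one
    then show ?case by (intro bexI[of _ "[]"]) auto
  next
    case (incl h)
    then show ?case by (intro bexI[of _ "[h]"]) auto
  next
    case (inv h)
    then show ?case by (intro bexI[of _ "[h]"]) (auto simp: S_inv)
  next
    case (eng h1 h2)
    then obtain u v where "u \<in> lists S" "v \<in> lists S" "word_prod W u = h1" "word_prod W v = h2"
      by blast
    then show ?case by (intro bexI[of _ "u @ v"]) (auto simp: word_prod_append)
  qed
  with that show thesis by blast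
qed

abbreviation len :: "'g \<Rightarrow> nat" where
  "len \<equiv> cox_length W S"

lemma reduced_word_exists:
  assumes "g \<in> carrier W"
  obtains w where "w \<in> lists S" "word_prod W w = g" "length w = len g"
proof -
  obtain w where "w \<in> lists S" "word_prod W w = g"
    using assms word_exists by blast
  then have "\<exists>n. \<exists>w \<in> lists S. length w = n \<and> word_prod W w = g"
    by auto
  from LeastI_ex[OF this] that show thesis
    unfolding cox_length_def by auto
qed

lemma len_word_prod_le: "w \<in> lists S \<Longrightarrow> len (word_prod W w) \<le> length w"
  unfolding cox_length_def by (rule Least_le) auto

lemma len_mult_le:
  assumes "g \<in> carrier W" "h \<in> carrier W"
  shows "len (g \<otimes> h) \<le> len g + len h"
proof -
  obtain u where u: "u \<in> lists S" "word_prod W u = g" "length u = len g"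
    using assms reduced_word_exists by blast
  obtain v where v: "v \<in> lists S" "word_prod W v = h" "length v = len h"
    using assms reduced_word_exists by blast
  show ?thesis
    using len_word_prod_le[of "u @ v"] u v by (simp add: word_prod_append)
qed

lemma len_inv_le:
  assumes "g \<in> carrier W"
  shows "len (inv g) \<le> len g"
proof -
  obtain u where u: "u \<in> lists S" "word_prod W u = g" "length u = len g"
    using assms reduced_word_exists by blast
  then have "rev u \<in> lists S"
    by auto
  with u show ?thesis
    using len_word_prod_le[of "rev u"] by (simp add: word_prod_rev)
qed

lemma len_inv: "g \<in> carrier W \<Longrightarrow> len (inv g) = len g"
  using len_inv_le[of g] len_inv_le[of "inv g"] by simp

end

section \<open>Reflections in a Euclidean space\<close>

lemma reflection_along_minus: "reflection_along (- v) = reflection_along v"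
  by (rule ext) (simp add: reflection_along_def)

lemma reflection_along_self: "v \<noteq> 0 \<Longrightarrow> reflection_along v v = - v"
  by (simp add: reflection_along_def scaleR_2 flip: scaleR_scaleR)

lemma reflection_along_conj:
  assumes "orthogonal_transformation f" "orthogonal_transformation h" "f \<circ> h = id"
  shows "f \<circ> reflection_along v \<circ> h = reflection_along (f v)"
proof
  fix x
  have fh: "f (h y) = y" for y
    using assms(3) by (simp add: fun_eq_iff)
  have lin: "linear f"
    using assms(1) by (rule orthogonal_transformation_linear)
  have inner: "f y \<bullet> f z = y \<bullet> z" for y z
    using assms(1) by (simp add: orthogonal_transformation_def)
  show "(f \<circ> reflection_along v \<circ> h) x = reflection_along (f v) x"
    using inner[of "h x" v] inner[of v v]
    by (simp add: reflection_along_def linear_diff[OF lin] linear_scale[OF lin] fh)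
qed

text \<open>The common reflection negates \<open>u\<close>; as the reflection along \<open>v\<close>
  changes \<open>u\<close> only by a multiple of \<open>v\<close>, this makes \<open>2 u\<close>
  such a multiple.\<close>

lemma reflection_along_eq_imp_span:
  assumes "reflection_along u = reflection_along v" "u \<noteq> 0" "v \<noteq> 0"
  shows "u \<in> span {v}"
proof -
  have "reflection_along v u = - u"
    using assms by (metis reflection_along_self)
  then have "u + u = (2 * (u \<bullet> v) / (v \<bullet> v)) *\<^sub>R v"
    by (simp add: reflection_along_def algebra_simps)
  then have "2 *\<^sub>R u = (2 * (u \<bullet> v) / (v \<bullet> v)) *\<^sub>R v"
    by (simp add: scaleR_2)
  then have "(1/2) *\<^sub>R (2 *\<^sub>R u) = (1/2) *\<^sub>R ((2 * (u \<bullet> v) / (v \<bullet> v)) *\<^sub>R v)"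
    by simp
  then have "u = ((u \<bullet> v) / (v \<bullet> v)) *\<^sub>R v"
    by simp
  then show ?thesis
    by (metis span_base span_scale singletonI)
qed

section \<open>Positive roots and the exchange property\<close>

context finite_coxeter_system
begin

lemma finite_S: "finite S"
  using finite_carrier S_carrier finite_subset by blast

lemma act_linear: "g \<in> carrier W \<Longrightarrow> linear (act g)"
  using act_orthogonal orthogonal_transformation_linear by blast

lemmas act_add = linear_add[OF act_linear]
  and act_neg = linear_neg[OF act_linear]
  and act_scale = linear_scale[OF act_linear]

lemma act_mult': "\<lbrakk>g \<in> carrier W; h \<in> carrier W\<rbrakk> \<Longrightarrow> act (g \<otimes> h) x = act g (act h x)"
  by (simp add: act_mult)

lemma act_inv [simp]:
  assumes "g \<in> carrier W"
  shows "act (inv g) (act g x) = x" "act g (act (inv g) x) = x"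
  using assms act_mult'[of "inv g" g x] act_mult'[of g "inv g" x] by (simp_all add: act_one)

lemma act_root: "\<lbrakk>g \<in> carrier W; \<beta> \<in> \<Phi>\<rbrakk> \<Longrightarrow> act g \<beta> \<in> \<Phi>"
  using roots_invariant by blast

lemma root_nonzero: "\<beta> \<in> \<Phi> \<Longrightarrow> \<beta> \<noteq> 0"
  using roots_reflecting by (auto simp: reflecting_vectors_def)

lemma simple_root [simp, intro]: "s \<in> S \<Longrightarrow> \<alpha> s \<in> \<Phi>"
  using simple_roots by auto

lemma root_line:
  assumes "\<beta> \<in> \<Phi>" "\<gamma> \<in> \<Phi>" "\<gamma> \<in> span {\<beta>}"
  shows "\<gamma> = \<beta> \<or> \<gamma> = - \<beta>"
proof -
  obtain \<delta> where "\<Phi> \<inter> span {\<beta>} = {\<delta>, - \<delta>}"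
    using roots_opposite[of \<beta>] assms(1) roots_reflecting by blast
  moreover have "\<beta> \<in> \<Phi> \<inter> span {\<beta>}" "\<gamma> \<in> \<Phi> \<inter> span {\<beta>}"
    using assms by (simp_all add: span_base)
  ultimately have "\<beta> = \<delta> \<or> \<beta> = - \<delta>" "\<gamma> = \<delta> \<or> \<gamma> = - \<delta>"
    by blast+
  then show ?thesis
    by (metis add.inverse_inverse)
qed

lemma root_minus:
  assumes "\<beta> \<in> \<Phi>"
  shows "- \<beta> \<in> \<Phi>"
proof -
  obtain \<delta> where \<delta>: "\<Phi> \<inter> span {\<beta>} = {\<delta>, - \<delta>}"
    using roots_opposite[of \<beta>] assms roots_reflecting by blast
  have "\<beta> \<in> {\<delta>, - \<delta>}"
    unfolding \<delta>[symmetric] using assms by (simp add: span_base)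
  then have "- \<beta> \<in> {\<delta>, - \<delta>}"
    by auto
  then show ?thesis
    unfolding \<delta>[symmetric] by simp
qed

lemma act_simple_neg: "s \<in> S \<Longrightarrow> act s (\<alpha> s) = - \<alpha> s"
  by (simp add: act_simple reflection_along_self root_nonzero)

text \<open>The cone spanned by the simple roots, without zero, for arbitrary vectors. As
  \<open>representation\<close> vanishes outside the span, membership in the span is demanded
  separately.\<close>

definition pos :: "'v \<Rightarrow> bool" where
  "pos v \<longleftrightarrow> v \<noteq> 0 \<and> v \<in> span (\<alpha> ` S) \<and> (\<forall>b. representation (\<alpha> ` S) v b \<ge> 0)"

lemma pos_simple [simp]: "s \<in> S \<Longrightarrow> pos (\<alpha> s)"
  by (simp add: pos_def root_nonzero span_base representation_basis simple_independent)

lemma representation_eq_0D: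
  assumes "v \<in> span (\<alpha> ` S)" "\<And>b. representation (\<alpha> ` S) v b = 0"
  shows "v = 0"
  using sum_representation_eq[OF simple_independent assms(1), of "\<alpha> ` S"] finite_S assms(2)
  by simp

lemma pos_not_neg: "pos v \<Longrightarrow> \<not> pos (- v)"
proof
  assume *: "pos v" "pos (- v)"
  have "representation (\<alpha> ` S) v b = 0" for b
    using * representation_neg[OF simple_independent, of v]
    by (force simp: pos_def intro: antisym)
  with * show False
    using representation_eq_0D by (auto simp: pos_def)
qed

lemma pos_sum:
  assumes "\<And>s. s \<in> S \<Longrightarrow> c s \<ge> 0" "(\<Sum>s\<in>S. c s *\<^sub>R \<alpha> s) \<noteq> 0"
  shows "pos (\<Sum>s\<in>S. c s *\<^sub>R \<alpha> s)"
proof -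
  have "representation (\<alpha> ` S) (\<Sum>s\<in>S. c s *\<^sub>R \<alpha> s) b \<ge> 0" for b
    by (subst representation_sum)
      (auto simp: simple_independent span_base span_scale representation_scale
        representation_basis assms(1) intro!: sum_nonneg)
  moreover have "(\<Sum>s\<in>S. c s *\<^sub>R \<alpha> s) \<in> span (\<alpha> ` S)"
    by (intro span_sum span_scale span_base) auto
  ultimately show ?thesis
    using assms(2) by (simp add: pos_def)
qed

lemma root_pos_or_neg:
  assumes "\<beta> \<in> \<Phi>"
  shows "pos \<beta> \<or> pos (- \<beta>)"
proof -
  obtain c where c: "\<forall>s\<in>S. c s \<ge> 0"
    "\<beta> = (\<Sum>s\<in>S. c s *\<^sub>R \<alpha> s) \<or> \<beta> = - (\<Sum>s\<in>S. c s *\<^sub>R \<alpha> s)"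
    using simple_signs[OF assms] by blast
  have "pos (\<Sum>s\<in>S. c s *\<^sub>R \<alpha> s)"
    using c root_nonzero[OF assms] by (intro pos_sum) auto
  with c(2) show ?thesis by auto
qed

lemma not_pos_root: "\<beta> \<in> \<Phi> \<Longrightarrow> \<not> pos \<beta> \<longleftrightarrow> pos (- \<beta>)"
  using root_pos_or_neg pos_not_neg by blast

lemma pos_add: "\<lbrakk>pos u; pos v\<rbrakk> \<Longrightarrow> pos (u + v)"
proof -
  assume u: "pos u" and v: "pos v"
  have rep: "representation (\<alpha> ` S) (u + v) b
      = representation (\<alpha> ` S) u b + representation (\<alpha> ` S) v b" for b
    using u v by (simp add: representation_add simple_independent pos_def)
  have "u + v \<noteq> 0"
    using u v pos_not_neg by (metis add.inverse_unique)
  then show ?thesis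
    using u v by (auto simp: pos_def rep span_add)
qed

lemma pos_scale: "\<lbrakk>pos v; c > 0\<rbrakk> \<Longrightarrow> pos (c *\<^sub>R v)"
  by (auto simp: pos_def representation_scale simple_independent span_scale)

lemma pos_combination:
  assumes "x \<ge> 0" "y \<ge> 0" "x \<noteq> 0 \<or> y \<noteq> 0" "pos u" "pos v"
  shows "pos (x *\<^sub>R u + y *\<^sub>R v)"
  using assms pos_add pos_scale by (cases "x = 0"; cases "y = 0") auto

text \<open>Compare coefficients: away from \<open>\<alpha> s\<close>, those of
  \<open>\<beta>\<close> are both nonnegative and nonpositive. So \<open>\<beta>\<close> lies on the
  line of \<open>\<alpha> s\<close>, which contains only two opposite roots.\<close>

lemma pos_minus_multiple_simple:
  assumes s: "s \<in> S" and \<beta>: "\<beta> \<in> \<Phi>" "pos \<beta>" "pos (x *\<^sub>R \<alpha> s - y *\<^sub>R \<beta>)" and y: "y > 0"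
  shows "\<beta> = \<alpha> s"
proof -
  let ?r = "representation (\<alpha> ` S)"
  have sp: "\<beta> \<in> span (\<alpha> ` S)" "\<alpha> s \<in> span (\<alpha> ` S)"
    using \<beta> s by (auto simp: pos_def span_base)
  have rep: "?r (x *\<^sub>R \<alpha> s - y *\<^sub>R \<beta>) b = x * (if b = \<alpha> s then 1 else 0) - y * ?r \<beta> b" for b
    using sp s by (simp add: representation_diff representation_scale simple_independent span_scale
        representation_basis)
  have "?r \<beta> b = 0" if "b \<noteq> \<alpha> s" for b
  proof -
    have "?r \<beta> b \<ge> 0" "- (y * ?r \<beta> b) \<ge> 0"
      using \<beta>(2,3) rep[of b] that unfolding pos_def by (simp_all only: if_False mult_zero_right diff_0) metis
    with y show ?thesis
      by (simp add: mult_le_0_iff)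
  qed
  moreover have "\<beta> = (\<Sum>b\<in>\<alpha> ` S. ?r \<beta> b *\<^sub>R b)"
    using sum_representation_eq[OF simple_independent sp(1), of "\<alpha> ` S"] finite_S by simp
  moreover have "(\<Sum>b\<in>\<alpha> ` S. ?r \<beta> b *\<^sub>R b)
      = (\<Sum>b\<in>\<alpha> ` S. if b = \<alpha> s then ?r \<beta> (\<alpha> s) *\<^sub>R \<alpha> s else 0)"
    by (rule sum.cong) (auto simp: calculation(1))
  ultimately have "\<beta> = ?r \<beta> (\<alpha> s) *\<^sub>R \<alpha> s"
    using s finite_S by (simp add: sum.delta)
  then have "\<beta> \<in> span {\<alpha> s}"
    by (metis span_base span_scale singletonI)
  then have "\<beta> = \<alpha> s \<or> \<beta> = - \<alpha> s"
    using root_line \<beta>(1) s by blast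
  then show ?thesis
    using pos_not_neg \<beta>(2) s by auto
qed

text \<open>The reflection \<open>s\<close> changes \<open>\<beta>\<close> by a multiple of
  \<open>\<alpha> s\<close>, so a negative image has the shape excluded by
  \<open>pos_minus_multiple_simple\<close> for every other root.\<close>

lemma simple_reflection_pos:
  assumes "s \<in> S" "\<beta> \<in> \<Phi>" "pos \<beta>" "\<not> pos (act s \<beta>)"
  shows "\<beta> = \<alpha> s"
proof -
  have "pos (- act s \<beta>)"
    using assms not_pos_root act_root by blast
  then show ?thesis
    using pos_minus_multiple_simple[OF assms(1-3), of _ 1]
    by (auto simp: act_simple[OF assms(1)] reflection_along_def algebra_simps)
qed

lemma act_conj:
  assumes "s \<in> S" "g \<in> carrier W"
  shows "act (g \<otimes> s \<otimes> inv g) = reflection_along (act g (\<alpha> s))"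
proof -
  have "act (g \<otimes> s \<otimes> inv g) = act g \<circ> reflection_along (\<alpha> s) \<circ> act (inv g)"
    using assms by (simp add: act_mult act_simple)
  also have "\<dots> = reflection_along (act g (\<alpha> s))"
    by (rule reflection_along_conj) (use assms in \<open>auto simp: act_orthogonal\<close>)
  finally show ?thesis .
qed

text \<open>Conjugates of generators act as reflections along the transported simple roots; two such
  reflections agree iff the roots span the same line, and faithfulness lifts this to the
  group.\<close>

lemma conj_eq_iff:
  assumes "s \<in> S" "g \<in> carrier W" "t \<in> S" "h \<in> carrier W"
  shows "g \<otimes> s \<otimes> inv g = h \<otimes> t \<otimes> inv h \<longleftrightarrow>
    act g (\<alpha> s) = act h (\<alpha> t) \<or> act g (\<alpha> s) = - act h (\<alpha> t)" (is "?L \<longleftrightarrow> ?R")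
proof
  assume ?L
  then have "reflection_along (act g (\<alpha> s)) = reflection_along (act h (\<alpha> t))"
    using assms act_conj by metis
  then have "act g (\<alpha> s) \<in> span {act h (\<alpha> t)}"
    using assms by (intro reflection_along_eq_imp_span root_nonzero act_root) auto
  then show ?R
    using assms by (intro root_line act_root) auto
next
  assume ?R
  then have "act (g \<otimes> s \<otimes> inv g) = act (h \<otimes> t \<otimes> inv h)"
    using assms by (auto simp: act_conj reflection_along_minus)
  then show ?L
    using assms by (intro inj_onD[OF act_faithful]) auto
qed

text \<open>Applying the letters from the right, the root of \<open>s\<close> becomes negative at
  some letter \<open>a\<close>. There it is the simple root of \<open>a\<close>, so \<open>s\<close>
  moved to the left past the tail becomes \<open>a\<close> and cancels that letter.\<close>

lemma exchange:
  assumes "w \<in> lists S" "s \<in> S" "\<not> pos (act (word_prod W w) (\<alpha> s))"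
  shows "\<exists>w' \<in> lists S. length w' < length w \<and> word_prod W w' = word_prod W w \<otimes> s"
  using assms(1,3)
proof (induction w)
  case Nil
  then show ?case using assms(2) by (simp add: act_one)
next
  case (Cons a u)
  then have [simp]: "a \<in> S" "u \<in> lists S" by auto
  show ?case
  proof (cases "pos (act (word_prod W u) (\<alpha> s))")
    case False
    with Cons obtain u' where "u' \<in> lists S" "length u' < length u"
      "word_prod W u' = word_prod W u \<otimes> s" by auto
    then show ?thesis
      using assms(2) by (intro bexI[of _ "a # u'"]) (auto simp: m_assoc)
  next
    case True
    \<comment> \<open>The right side is written as an image under the identity so that
      \<open>conj_eq_iff\<close> applies.\<close>
    have "act (word_prod W u) (\<alpha> s) = act \<one> (\<alpha> a)"
      unfolding act_one id_apply
      using True Cons.prems assms(2)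
      by (intro simple_reflection_pos) (auto simp: act_mult' act_root)
    then have "word_prod W u \<otimes> s \<otimes> inv (word_prod W u) = a"
      using conj_eq_iff[of s "word_prod W u" a \<one>] assms(2) by simp
    then have "word_prod W u \<otimes> s = a \<otimes> word_prod W u"
      using assms(2) by (metis S_closed \<open>a \<in> S\<close> \<open>u \<in> lists S\<close> inv_solve_right m_closed
          word_prod_closed inv_equality inv_inv inv_closed)
    then have "word_prod W (a # u) \<otimes> s = word_prod W u"
      using assms(2) by (simp add: m_assoc) (simp add: S_square flip: m_assoc)
    then show ?thesis
      by (intro bexI[of _ u]) auto
  qed
qed

text \<open>Otherwise \<open>exchange\<close>, applied to a reduced word of \<open>g\<close>, would
  give \<open>g \<otimes> s\<close> a word shorter than \<open>len g\<close>.\<close>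

lemma pos_if_len_increases:
  assumes "g \<in> carrier W" "s \<in> S" "len g \<le> len (g \<otimes> s)"
  shows "pos (act g (\<alpha> s))"
proof (rule ccontr)
  assume *: "\<not> ?thesis"
  obtain w where w: "w \<in> lists S" "word_prod W w = g" "length w = len g"
    using assms reduced_word_exists by blast
  then obtain w' where "w' \<in> lists S" "length w' < length w" "word_prod W w' = g \<otimes> s"
    using exchange[of w s] * assms by auto
  then show False
    using len_word_prod_le[of w'] w assms by simp
qed

end

section \<open>Root functions and flips\<close>

lemma nths_restrict: "nths xs A = nths xs (A \<inter> {..<length xs})"
  by (auto simp: nths_def set_zip intro!: arg_cong[where f = "map fst"] filter_cong)

lemma nths_lessThan_Suc:
  assumes "x < length xs"
  shows "nths xs ({..<Suc x} - I) = nths xs ({..<x} - I) @ (if x \<in> I then [] else [xs ! x])"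
proof -
  have split: "nths xs A = nths (take x xs) A @ nths (xs ! x # drop (Suc x) xs) {j. j + x \<in> A}" for A
    using assms nths_append[of "take x xs" "xs ! x # drop (Suc x) xs" A]
    by (simp flip: id_take_nth_drop)
  have "nths (take x xs) ({..<Suc x} - I) = nths (take x xs) ({..<x} - I)"
    using assms nths_restrict[of "take x xs" "{..<Suc x} - I"]
      nths_restrict[of "take x xs" "{..<x} - I"]
    by (auto intro!: arg_cong[where f = "nths _"])
  moreover have "{j. Suc (j + x) < x} = {}" "{j. j + x < x} = {}" "{j. j + x < x \<and> P j} = {}"
    for P by auto
  ultimately show ?thesis
    by (simp add: split nths_Cons)
qed

section \<open>Prefix products, root functions and inversions\<close>

locale subword_complex = finite_coxeter_system W S act \<Phi> \<alpha>
  for W :: "('g, 'b) monoid_scheme" (structure) and S :: "'g set"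
    and act :: "'g \<Rightarrow> 'v::euclidean_space \<Rightarrow> 'v" and \<Phi> :: "'v set" and \<alpha> :: "'g \<Rightarrow> 'v" +
  fixes Q :: "'g list" and \<rho> :: 'g
  assumes Q_word: "Q \<in> lists S" and \<rho>_closed: "\<rho> \<in> carrier W"
begin

abbreviation m :: nat where "m \<equiv> length Q"
abbreviation Fac :: "nat set set" where "Fac \<equiv> facets W S Q \<rho>"
abbreviation rt :: "nat set \<Rightarrow> nat \<Rightarrow> 'v" where "rt \<equiv> root_function W act \<alpha> Q"

text \<open>The group element in the root function. It is also needed for sets such as
  \<open>I - {i}\<close> that are not facets.\<close>

definition pre :: "nat set \<Rightarrow> nat \<Rightarrow> 'g" where
  "pre I x = word_prod W (nths Q ({..<x} - I))"

lemma Q_nth [simp, intro]: "k < m \<Longrightarrow> Q ! k \<in> S"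
  using Q_word nth_mem by (auto simp: in_lists_conv_set)

lemma nths_word: "nths Q A \<in> lists S"
  using Q_word in_set_nthsD by (force simp: in_lists_conv_set)

lemma pre_closed [simp, intro]: "pre I x \<in> carrier W"
  by (simp add: pre_def nths_word)

lemma pre_0 [simp]: "pre I 0 = \<one>"
  by (simp add: pre_def)

lemma pre_Suc: "x < m \<Longrightarrow> pre I (Suc x) = (if x \<in> I then pre I x else pre I x \<otimes> Q ! x)"
  by (simp add: pre_def nths_lessThan_Suc word_prod_append nths_word)

lemma pre_cong: "I \<inter> {..<x} = J \<inter> {..<x} \<Longrightarrow> pre I x = pre J x"
  unfolding pre_def by (rule arg_cong[where f = "\<lambda>A. word_prod W (nths Q A)"]) auto

lemma rt_eq: "rt I k = act (pre I k) (\<alpha> (Q ! k))"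
  by (simp add: root_function_def pre_def)

lemma rt_root [simp, intro]: "k < m \<Longrightarrow> rt I k \<in> \<Phi>"
  by (simp add: rt_eq act_root)

lemma rt_cong: "I \<inter> {..<k} = J \<inter> {..<k} \<Longrightarrow> rt I k = rt J k"
  by (simp add: rt_eq pre_cong[of I k J])

lemma rt_pull_back: "act (inv (pre I k)) (rt I k) = \<alpha> (Q ! k)"
  by (simp add: rt_eq)

lemma facet_iff: "I \<in> Fac \<longleftrightarrow> I \<subseteq> {..<m} \<and> pre I m = \<rho> \<and> card ({..<m} - I) = len \<rho>"
proof -
  have "length (nths Q ({..<m} - I)) = card ({..<m} - I)"
    unfolding length_nths by (rule arg_cong[where f = card]) auto
  then show ?thesis
    by (auto simp: facets_def reduced_expression_def pre_def nths_word)
qed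

lemma facet_less: "\<lbrakk>I \<in> Fac; k \<in> I\<rbrakk> \<Longrightarrow> k < m"
  by (auto simp: facet_iff)

lemma segment_card_Suc:
  "x \<le> y \<Longrightarrow> card ({x..<Suc y} - I) = card ({x..<y} - I) + (if y \<in> I then 0 else 1)"
  by (simp add: atLeastLessThanSuc insert_Diff_if)

lemma len_S: "s \<in> S \<Longrightarrow> len s \<le> 1"
  using len_word_prod_le[of "[s]"] by simp

lemma len_segment_le:
  assumes "x \<le> y" "y \<le> m"
  shows "len (inv (pre I x) \<otimes> pre I y) \<le> card ({x..<y} - I)"
  using assms
proof (induction y rule: dec_induct)
  case base
  then show ?case using len_word_prod_le[of "[]"] by simp
next
  case (step y)
  then have y: "y < m" by simp
  have "len (inv (pre I x) \<otimes> (pre I y \<otimes> Q ! y)) \<le> len (inv (pre I x) \<otimes> pre I y) + 1"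
    using len_mult_le[of "inv (pre I x) \<otimes> pre I y" "Q ! y"] len_S[of "Q ! y"] y
    by (simp add: m_assoc)
  then show ?case
    using step y by (auto simp: pre_Suc segment_card_Suc)
qed

lemma segment_mult:
  "inv (pre I x) \<otimes> pre I y \<otimes> (inv (pre I y) \<otimes> pre I z) = inv (pre I x) \<otimes> pre I z"
proof -
  have "pre I y \<otimes> (inv (pre I y) \<otimes> pre I z) = pre I z"
    by (simp flip: m_assoc)
  then show ?thesis
    by (simp add: m_assoc)
qed

text \<open>Factors of a reduced word are reduced: \<open>\<rho>\<close> splits into three factors,
  none longer than its number of letters, and these numbers add up to
  \<open>len \<rho>\<close>.\<close>

lemma len_segment:
  assumes "I \<in> Fac" "x \<le> y" "y \<le> m"
  shows "len (inv (pre I x) \<otimes> pre I y) = card ({x..<y} - I)"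
proof (rule antisym[OF len_segment_le])
  have "{..<m} - I = ({0..<x} - I) \<union> (({x..<y} - I) \<union> ({y..<m} - I))"
    using assms by auto
  moreover have "card (({0..<x} - I) \<union> (({x..<y} - I) \<union> ({y..<m} - I)))
      = card ({0..<x} - I) + card (({x..<y} - I) \<union> ({y..<m} - I))"
    using assms by (intro card_Un_disjoint) auto
  moreover have "card (({x..<y} - I) \<union> ({y..<m} - I)) = card ({x..<y} - I) + card ({y..<m} - I)"
    by (intro card_Un_disjoint) auto
  ultimately have "card ({..<m} - I) = card ({0..<x} - I) + (card ({x..<y} - I) + card ({y..<m} - I))"
    by simp
  then have "len \<rho> = card ({0..<x} - I) + (card ({x..<y} - I) + card ({y..<m} - I))"
    using assms(1) by (simp add: facet_iff)
  moreover have "\<rho> = inv (pre I 0) \<otimes> pre I x \<otimes> ((inv (pre I x) \<otimes> pre I y) \<otimes> (inv (pre I y) \<otimes> pre I m))"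
    using assms(1) using \<rho>_closed by (simp add: segment_mult facet_iff flip: m_assoc)
  then have "len \<rho> \<le> len (inv (pre I 0) \<otimes> pre I x)
      + len ((inv (pre I x) \<otimes> pre I y) \<otimes> (inv (pre I y) \<otimes> pre I m))"
    by (metis len_mult_le inv_closed m_closed pre_closed)
  moreover have "len ((inv (pre I x) \<otimes> pre I y) \<otimes> (inv (pre I y) \<otimes> pre I m)) \<le>
      len (inv (pre I x) \<otimes> pre I y) + len (inv (pre I y) \<otimes> pre I m)"
    by (intro len_mult_le) auto
  ultimately show "card ({x..<y} - I) \<le> len (inv (pre I x) \<otimes> pre I y)"
    using len_segment_le[of 0 x I] len_segment_le[of y m I] assms by linarith
qed (use assms in auto)

text \<open>The letters from \<open>x\<close> up to and including \<open>k\<close> form a reduced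
  word, so appending the letter at \<open>k\<close> increases the length. Applying
  \<open>inv (pre I x)\<close> means viewing a root from position \<open>x\<close>.\<close>

lemma rt_pos_before:
  assumes "I \<in> Fac" "k < m" "k \<notin> I" "x \<le> k"
  shows "pos (act (inv (pre I x)) (rt I k))"
proof -
  have "len (inv (pre I x) \<otimes> pre I k \<otimes> Q ! k) = len (inv (pre I x) \<otimes> pre I (Suc k))"
    using assms by (simp add: pre_Suc m_assoc)
  then have "pos (act (inv (pre I x) \<otimes> pre I k) (\<alpha> (Q ! k)))"
    using assms by (intro pos_if_len_increases) (auto simp: len_segment segment_card_Suc)
  then show ?thesis
    by (simp add: rt_eq act_mult')
qed

text \<open>The same argument for the word read backwards from \<open>x\<close> to \<open>k\<close>.
  The letter at \<open>k\<close> is now included in the prefix and negates its simple root.\<close>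

lemma rt_neg_after:
  assumes "I \<in> Fac" "k < x" "x \<le> m" "k \<notin> I"
  shows "pos (- act (inv (pre I x)) (rt I k))"
proof -
  have k: "k < m" using assms by simp
  let ?h = "inv (pre I x) \<otimes> pre I (Suc k)"
  have inverse: "len (inv (pre I x) \<otimes> pre I y) = card ({y..<x} - I)" if "y \<le> x" for y
    using len_inv[of "inv (pre I y) \<otimes> pre I x"] len_segment[OF assms(1) that assms(3)]
    by (simp add: inv_mult_group)
  have "?h \<otimes> Q ! k = inv (pre I x) \<otimes> pre I k"
    using k assms(4) by (simp add: pre_Suc m_assoc S_square)
  moreover have "{k..<x} - I = insert k ({Suc k..<x} - I)"
    using assms by auto
  then have "card ({k..<x} - I) = Suc (card ({Suc k..<x} - I))"
    by simp
  ultimately have "pos (act ?h (\<alpha> (Q ! k)))"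
    using assms k by (intro pos_if_len_increases) (auto simp: inverse)
  then show ?thesis
    using k assms(4) by (simp add: rt_eq act_mult' pre_Suc act_simple_neg act_neg)
qed

text \<open>A positive root that looks negative from \<open>x\<close> changed sign at some letter
  before \<open>x\<close>, and a letter changes the sign only of its own simple root.\<close>

lemma inversion_before:
  assumes "\<beta> \<in> \<Phi>" "pos \<beta>" "x \<le> m" "\<not> pos (act (inv (pre I x)) \<beta>)"
  shows "\<exists>k < x. k \<notin> I \<and> rt I k = \<beta>"
  using assms(3,4)
proof (induction x)
  case 0
  then show ?case using assms(2) by (simp add: act_one)
next
  case (Suc x)
  show ?case
  proof (cases "pos (act (inv (pre I x)) \<beta>)")
    case True
    with Suc.prems have "x \<notin> I" by (auto simp: pre_Suc)
    then have "\<not> pos (act (Q ! x) (act (inv (pre I x)) \<beta>))"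
      using Suc.prems by (simp add: pre_Suc inv_mult_group S_inv act_mult')
    then have "act (inv (pre I x)) \<beta> = \<alpha> (Q ! x)"
      using Suc.prems True assms(1) by (intro simple_reflection_pos) (auto intro: act_root)
    then have "rt I x = \<beta>"
      unfolding rt_eq by (metis act_inv(2) pre_closed)
    with \<open>x \<notin> I\<close> show ?thesis by auto
  next
    case False
    with Suc show ?thesis using less_SucI by fastforce
  qed
qed

text \<open>The inversion set of \<open>\<rho>\<close>. For every facet, the root function maps the
  positions outside the facet bijectively onto it.\<close>

definition inversions :: "'v set" where
  "inversions = {\<beta> \<in> \<Phi>. pos \<beta> \<and> pos (- act (inv \<rho>) \<beta>)}"

lemma rt_inversion: "\<lbrakk>I \<in> Fac; k < m; k \<notin> I\<rbrakk> \<Longrightarrow> rt I k \<in> inversions"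
  using rt_pos_before[of I k 0] rt_neg_after[of I k m]
  by (auto simp: inversions_def facet_iff act_one)

lemma inversion_rt:
  assumes "\<beta> \<in> inversions" "I \<in> Fac"
  obtains k where "k < m" "k \<notin> I" "rt I k = \<beta>"
  using inversion_before[of \<beta> m I] assms pos_not_neg
  by (auto simp: inversions_def facet_iff)

lemma inversion_pos: "\<beta> \<in> inversions \<Longrightarrow> pos \<beta>"
  by (simp add: inversions_def)

text \<open>Viewed from position \<open>l\<close>, the root at \<open>l\<close> is simple and the
  root at \<open>k\<close> is negative.\<close>

lemma rt_less_neq: "\<lbrakk>I \<in> Fac; k < l; l < m; k \<notin> I; l \<notin> I\<rbrakk> \<Longrightarrow> rt I k \<noteq> rt I l"
  using rt_pos_before[of I l l] rt_neg_after[of I k l] pos_not_neg by auto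

lemma rt_inj: "\<lbrakk>I \<in> Fac; k < m; l < m; k \<notin> I; l \<notin> I; rt I k = rt I l\<rbrakk> \<Longrightarrow> k = l"
  using rt_less_neq by (metis nat_neq_iff)

text \<open>If \<open>j\<close> came before \<open>i\<close>, the root at \<open>j\<close> would be
  negative when viewed from \<open>i\<close>, whereas the root at \<open>i\<close> is simple
  there.\<close>

lemma rt_eq_imp_less:
  assumes "I \<in> Fac" "i \<in> I" "j < m" "j \<notin> I" "rt I i = rt I j"
  shows "i < j"
proof (rule ccontr)
  assume "\<not> i < j"
  with assms have "j < i" by (metis nat_neq_iff)
  then have "pos (- act (inv (pre I i)) (rt I j))"
    using rt_neg_after[of I j i] facet_less[of I i] assms(1,2,4) by simp
  then have "pos (- \<alpha> (Q ! i))"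
    unfolding assms(5)[symmetric] rt_pull_back .
  then show False
    using pos_not_neg[of "\<alpha> (Q ! i)"] facet_less[of I i] assms(1,2) by simp
qed

lemma rt_eq_minus_imp_greater:
  assumes "I \<in> Fac" "i \<in> I" "j < m" "j \<notin> I" "rt I i = - rt I j"
  shows "j < i"
proof (rule ccontr)
  assume "\<not> j < i"
  with assms have "i < j" by (metis nat_neq_iff)
  then have "pos (act (inv (pre I i)) (rt I j))"
    using rt_pos_before[of I j i] assms(1,3,4) by simp
  moreover have "rt I j = - rt I i" using assms(5) by simp
  ultimately have "pos (- \<alpha> (Q ! i))"
    by (simp add: act_neg rt_pull_back)
  then show False
    using pos_not_neg[of "\<alpha> (Q ! i)"] facet_less[of I i] assms(1,2) by simp
qed

section \<open>Reflections attached to positions, and flips\<close>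

definition refl_elem :: "nat set \<Rightarrow> nat \<Rightarrow> 'g" where
  "refl_elem I i = pre I i \<otimes> Q ! i \<otimes> inv (pre I i)"

lemma refl_elem_closed [simp, intro]: "i < m \<Longrightarrow> refl_elem I i \<in> carrier W"
  by (simp add: refl_elem_def)

lemma refl_elem_square: "i < m \<Longrightarrow> refl_elem I i \<otimes> refl_elem I i = \<one>"
proof -
  assume i: "i < m"
  have "inv (pre I i) \<otimes> (pre I i \<otimes> (Q ! i \<otimes> inv (pre I i))) = Q ! i \<otimes> inv (pre I i)"
    using i by (simp flip: m_assoc)
  moreover have "Q ! i \<otimes> (Q ! i \<otimes> inv (pre I i)) = inv (pre I i)"
    using i by (simp add: S_square flip: m_assoc)
  ultimately show ?thesis
    using i by (simp add: refl_elem_def m_assoc)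
qed

lemma refl_elem_cancel: "\<lbrakk>i < m; g \<in> carrier W\<rbrakk> \<Longrightarrow> refl_elem I i \<otimes> (refl_elem I i \<otimes> g) = g"
  by (simp add: refl_elem_square flip: m_assoc)

lemma act_refl_elem: "i < m \<Longrightarrow> act (refl_elem I i) = reflection_along (rt I i)"
  by (simp add: refl_elem_def act_conj rt_eq)

lemma refl_elem_eq_iff:
  "\<lbrakk>i < m; j < m\<rbrakk> \<Longrightarrow> refl_elem I i = refl_elem J j \<longleftrightarrow> rt I i = rt J j \<or> rt I i = - rt J j"
  unfolding refl_elem_def rt_eq by (rule conj_eq_iff) auto

text \<open>Putting the letter at \<open>i\<close> back into the word multiplies every later prefix
  on the left by the reflection in the root at \<open>i\<close>.\<close>

lemma pre_remove:
  assumes "i \<in> I" "i < m" "x \<le> m"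
  shows "pre (I - {i}) x = (if i < x then refl_elem I i \<otimes> pre I x else pre I x)"
  using assms(3)
proof (induction x)
  case (Suc x)
  have "refl_elem I x \<otimes> pre I x = pre I x \<otimes> Q ! x"
    using Suc.prems by (simp add: refl_elem_def m_assoc)
  with Suc assms show ?case
    by (cases "x = i") (auto simp: pre_Suc m_assoc)
qed simp

text \<open>The word of the common set \<open>I - {i}\<close> has a product that is both reflections
  times \<open>\<rho>\<close>; cancel \<open>\<rho>\<close>.\<close>

lemma flip_refl_elem:
  assumes "I \<in> Fac" "J \<in> Fac" "i \<in> I" "j \<in> J" "I - {i} = J - {j}"
  shows "refl_elem I i = refl_elem J j"
proof -
  have "refl_elem I i \<otimes> pre I m = refl_elem J j \<otimes> pre J m"
    using pre_remove[of i I m] pre_remove[of j J m] assms facet_less by auto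
  then show ?thesis
    using assms facet_less \<rho>_closed by (auto simp: facet_iff)
qed

text \<open>Both prefixes are compared with the prefix of the common set. The reflection is an
  involution, so it survives only if exactly one of \<open>i\<close> and \<open>j\<close> precedes
  \<open>x\<close>.\<close>

lemma flip_pre:
  assumes "I \<in> Fac" "J \<in> Fac" "i \<in> I" "j \<in> J" "I - {i} = J - {j}" "x \<le> m"
  shows "pre J x = (if (i < x) \<noteq> (j < x) then refl_elem I i \<otimes> pre I x else pre I x)"
proof -
  have ij: "i < m" "j < m" using assms facet_less by auto
  have t: "refl_elem I i = refl_elem J j"
    using flip_refl_elem assms by blast
  have "(if i < x then refl_elem I i \<otimes> pre I x else pre I x)
      = (if j < x then refl_elem I i \<otimes> pre J x else pre J x)"
    unfolding pre_remove[of i I x, OF assms(3) ij(1) assms(6), symmetric]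
    by (simp add: t assms(5) pre_remove[of j J x, OF assms(4) ij(2) assms(6)])
  moreover have "refl_elem I i \<otimes> (refl_elem I i \<otimes> pre J x) = pre J x"
    using ij by (intro refl_elem_cancel) auto
  ultimately show ?thesis
    using ij by (cases "i < x"; cases "j < x") (auto simp: refl_elem_closed)
qed

lemma flip_rt:
  assumes "I \<in> Fac" "J \<in> Fac" "i \<in> I" "j \<in> J" "I - {i} = J - {j}" "x < m"
  shows "rt J x = (if (i < x) \<noteq> (j < x) then reflection_along (rt I i) (rt I x) else rt I x)"
  using assms facet_less[of I i]
  by (simp add: rt_eq[of J x] rt_eq[of I x] flip_pre[OF assms(1-5)] act_mult' act_refl_elem)

lemma reflection_along_self_rt: "i < m \<Longrightarrow> reflection_along (rt I i) (rt I i) = - rt I i"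
  by (simp add: reflection_along_self root_nonzero)

lemma flip_rt_pm:
  assumes "I \<in> Fac" "J \<in> Fac" "i \<in> I" "j \<in> J" "I - {i} = J - {j}"
  shows "rt I i = rt I j \<or> rt I i = - rt I j"
proof -
  have ij: "i < m" "j < m" using assms facet_less by auto
  have pm: "rt I i = rt J j \<or> rt I i = - rt J j"
    using flip_refl_elem[OF assms] ij by (simp add: refl_elem_eq_iff)
  \<comment> \<open>This is \<open>flip_rt\<close> in the direction from \<open>J\<close> to
    \<open>I\<close>, evaluated at \<open>j\<close> itself.\<close>
  have "rt I j = (if (j < j) \<noteq> (i < j) then reflection_along (rt J j) (rt J j) else rt J j)"
    using assms ij by (intro flip_rt) auto
  with pm ij show ?thesis
    by (auto simp: reflection_along_self_rt split: if_splits)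
qed

text \<open>Inserting the letter at \<open>i\<close> and deleting the letter at \<open>j\<close>
  multiply the product by the same reflection, and the number of letters is kept.\<close>

lemma flip_facet:
  assumes "I \<in> Fac" "i \<in> I" "j < m" "j \<notin> I" "rt I i = rt I j \<or> rt I i = - rt I j"
  shows "insert j (I - {i}) \<in> Fac"
proof -
  let ?J = "insert j (I - {i})"
  have i: "i < m" "i \<noteq> j" using assms facet_less by auto
  have remove: "pre (I - {i}) x = (if i < x then refl_elem I i \<otimes> pre I x else pre I x)"
    "pre (I - {i}) x = (if j < x then refl_elem ?J j \<otimes> pre ?J x else pre ?J x)" if "x \<le> m" for x
    using pre_remove[of i I x] pre_remove[of j ?J x] assms that i by auto
  have "pre ?J j = (if i < j then refl_elem I i \<otimes> pre I j else pre I j)"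
    using remove[of j] assms(3) by simp
  \<comment> \<open>\<open>?J\<close> is not yet known to be a facet, so its root at
    \<open>j\<close> is computed from \<open>pre_remove\<close> and not from
    \<open>flip_rt\<close>.\<close>
  then have "rt ?J j = (if i < j then reflection_along (rt I i) (rt I j) else rt I j)"
    using i by (simp add: rt_eq[of ?J] rt_eq[of I j] act_mult' act_refl_elem)
  moreover have "reflection_along (rt I i) (rt I j) = - rt I j"
    using assms(5) reflection_along_self_rt[OF assms(3), of I] by (auto simp: reflection_along_minus)
  ultimately have "refl_elem I i = refl_elem ?J j"
    using assms(3,5) i by (auto simp: refl_elem_eq_iff)
  then have "refl_elem I i \<otimes> pre I m = refl_elem I i \<otimes> pre ?J m"
    using remove[of m] i assms(3) by simp
  then have "pre ?J m = \<rho>"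
    using i assms(1) by (simp add: facet_iff)
  moreover have "{..<m} - ?J = insert i ({..<m} - I - {j})"
    using i by auto
  moreover have "card (insert i ({..<m} - I - {j})) = Suc (card ({..<m} - I - {j}))"
    using assms(2) by (intro card_insert_disjoint) auto
  moreover have "Suc (card ({..<m} - I - {j})) = card ({..<m} - I)"
    using assms(3,4) by (intro card_Suc_Diff1) auto
  ultimately have "pre ?J m = \<rho>" "card ({..<m} - ?J) = card ({..<m} - I)"
    by simp_all
  then show ?thesis
    using assms(1,3) by (auto simp: facet_iff)
qed

end

section \<open>The increasing flip order\<close>

context subword_complex
begin

definition swap :: "nat set \<Rightarrow> nat \<Rightarrow> nat \<Rightarrow> nat set" where
  "swap K k n = insert n (K - {k})"

text \<open>Increasing flips in terms of roots: equality of the roots, as opposed to equality up to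
  sign, forces \<open>k < n\<close>.\<close>

definition up :: "nat set \<Rightarrow> nat \<Rightarrow> nat \<Rightarrow> bool" where
  "up K k n \<longleftrightarrow> K \<in> Fac \<and> k \<in> K \<and> n < m \<and> n \<notin> K \<and> rt K k = rt K n"

lemma upD:
  assumes "up K k n"
  shows "K \<in> Fac" "k \<in> K" "k < m" "n < m" "n \<notin> K" "rt K k = rt K n" "k < n" "k \<noteq> n"
    "rt K k \<in> inversions" "swap K k n \<in> Fac"
  using assms facet_less rt_eq_imp_less[of K k n] rt_inversion[of K n] flip_facet[of K k n]
  by (auto simp: up_def swap_def)

lemma ex_up:
  assumes "K \<in> Fac" "k \<in> K" "rt K k \<in> inversions"
  obtains n where "up K k n"
  using inversion_rt[OF assms(3,1)] assms by (metis up_def)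

lemma up_unique: "\<lbrakk>up K k n; up K k n'\<rbrakk> \<Longrightarrow> n = n'"
  unfolding up_def by (metis rt_inj)

text \<open>As \<open>k < n\<close>, exactly one of them precedes \<open>x\<close> iff
  \<open>x\<close> lies in the half-open range; the root at \<open>n\<close> is reflected, the one
  at \<open>k\<close> is not.\<close>

lemma rt_swap:
  assumes "up K k n" "x < m"
  shows "rt (swap K k n) x
    = (if k < x \<and> x \<le> n then reflection_along (rt K k) (rt K x) else rt K x)"
proof -
  note up = upD[OF assms(1)]
  have "rt (swap K k n) x
    = (if (k < x) \<noteq> (n < x) then reflection_along (rt K k) (rt K x) else rt K x)"
    by (rule flip_rt) (use up assms(2) in \<open>auto simp: swap_def\<close>)
  with up(7) show ?thesis by auto
qed

lemma rt_swap_ends: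
  assumes "up K k n"
  shows "rt (swap K k n) k = rt K k" "rt (swap K k n) n = - rt K k"
proof -
  note up = upD[OF assms]
  show "rt (swap K k n) k = rt K k"
    using rt_swap[OF assms up(3)] by simp
  show "rt (swap K k n) n = - rt K k"
    using rt_swap[OF assms up(4)] up reflection_along_self_rt[of k K] by simp
qed

text \<open>A flip exchanges positions with roots equal up to sign, and opposite roots would place
  \<open>j\<close> before \<open>i\<close>.\<close>

lemma increasing_flip_iff:
  "increasing_flip W S Q \<rho> I J \<longleftrightarrow> (\<exists>k n. up I k n \<and> J = swap I k n)"
proof
  assume "increasing_flip W S Q \<rho> I J"
  then obtain i j where ij: "I \<in> Fac" "J \<in> Fac" "i \<in> I" "j \<in> J" "I - {i} = J - {j}" "i < j"
    by (auto simp: increasing_flip_def)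
  have "j \<notin> I"
    using ij by blast
  moreover have "J = swap I i j"
    using ij by (auto simp: swap_def)
  moreover have "rt I i = rt I j"
    using flip_rt_pm[OF ij(1-5)] rt_eq_minus_imp_greater[of I i j] ij \<open>j \<notin> I\<close>
      facet_less[OF ij(2,4)] by auto
  ultimately show "\<exists>k n. up I k n \<and> J = swap I k n"
    using ij facet_less[OF ij(2,4)] by (auto simp: up_def)
next
  assume "\<exists>k n. up I k n \<and> J = swap I k n"
  then obtain k n where up: "up I k n" and J: "J = swap I k n" by blast
  note u = upD[OF up]
  have "I - {k} = J - {n}" "n \<in> J" "k \<notin> J"
    using u J by (auto simp: swap_def)
  then show "increasing_flip W S Q \<rho> I J"
    using u J unfolding increasing_flip_def by blast
qed

text \<open>Some position outside \<open>K\<close> carries each inversion, so it can be exchanged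
  with \<open>k\<close>.\<close>

lemma flippableI:
  assumes "K \<in> Fac" "k \<in> K" "rt K k \<in> inversions \<or> - rt K k \<in> inversions"
  shows "flippable W S Q \<rho> K k"
proof -
  obtain n where n: "n < m" "n \<notin> K" "rt K n = rt K k \<or> rt K n = - rt K k"
    using assms inversion_rt by metis
  then have "insert n (K - {k}) \<in> Fac"
    using assms by (intro flip_facet) auto
  moreover have "insert n (K - {k}) \<noteq> K" "K - {k} = insert n (K - {k}) - {n}"
    using n by auto
  ultimately show ?thesis
    using assms(2) unfolding flippable_def by blast
qed

section \<open>The order and agreement of prefixes\<close>

abbreviation fle :: "nat set \<Rightarrow> nat set \<Rightarrow> bool" where
  "fle I J \<equiv> (I, J) \<in> flip_order W S Q \<rho>"

lemma fle_refl: "I \<in> Fac \<Longrightarrow> fle I I"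
  using flip_order_partial_order[of W S Q \<rho>]
  by (auto simp: partial_order_on_def preorder_on_def refl_on_def)

lemma fle_trans: "\<lbrakk>fle I J; fle J K\<rbrakk> \<Longrightarrow> fle I K"
  using flip_order_partial_order[of W S Q \<rho>]
  by (auto simp: partial_order_on_def preorder_on_def dest: transD)

lemma fle_antisym: "\<lbrakk>fle I J; fle J I\<rbrakk> \<Longrightarrow> I = J"
  using flip_order_partial_order[of W S Q \<rho>]
  by (auto simp: partial_order_on_def dest: antisymD)

lemma fle_Fac: "fle I J \<Longrightarrow> I \<in> Fac \<and> J \<in> Fac"
  by (auto simp: flip_order_def flip_path_def)

lemma fle_up: "up K k n \<Longrightarrow> fle K (swap K k n)"
proof -
  assume up: "up K k n"
  then have "increasing_flip W S Q \<rho> K (swap K k n)"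
    by (auto simp: increasing_flip_iff)
  then have "flip_path W S Q \<rho> K (swap K k n) [K, swap K k n]"
    using upD[OF up] by (auto simp: flip_path_def)
  then show ?thesis
    by (auto simp: flip_order_def)
qed

text \<open>Induction on a path with fixed end \<open>J\<close>, removing its first edge; the
  remaining path is kept as a hypothesis.\<close>

lemma fle_induct [consumes 1, case_names refl up]:
  assumes "fle I J"
    and "P J"
    and "\<And>K k n. \<lbrakk>up K k n; fle (swap K k n) J; P (swap K k n)\<rbrakk> \<Longrightarrow> P K"
  shows "P I"
proof -
  obtain xs where "flip_path W S Q \<rho> I J xs"
    using assms(1) by (auto simp: flip_order_def)
  then show ?thesis
  proof (induction xs arbitrary: I)
    case Nil
    then show ?case by (simp add: flip_path_def)
  next
    case (Cons x xs)
    show ?case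
    proof (cases xs)
      case Nil
      then show ?thesis using Cons.prems assms(2) by (auto simp: flip_path_def)
    next
      case (Cons y ys)
      then have path: "flip_path W S Q \<rho> y J xs" and "increasing_flip W S Q \<rho> I y"
        using Cons.prems by (auto simp: flip_path_def)
      then obtain k n where "up I k n" "y = swap I k n"
        by (auto simp: increasing_flip_iff)
      moreover have "fle y J"
        using path by (auto simp: flip_order_def)
      ultimately show ?thesis
        using assms(3)[of I k n] Cons.IH[OF path] by simp
    qed
  qed
qed

lemma card_below_Suc:
  "card (I \<inter> {..<Suc x}) = card (I \<inter> {..<x}) + (if x \<in> I then 1 else 0)"
  by (simp add: lessThan_Suc)

text \<open>Along increasing flips positions move to the right, which makes agreement of prefixes convex.\<close>

lemma fle_card_below: "fle I J \<Longrightarrow> card (J \<inter> {..<x}) \<le> card (I \<inter> {..<x})"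
proof (induction rule: fle_induct)
  case (up K k n)
  have "card (swap K k n \<inter> {..<x}) \<le> card (K \<inter> {..<x})"
  proof (cases "k < x")
    case True
    have "swap K k n \<inter> {..<x} \<subseteq> insert n (K \<inter> {..<x} - {k})"
      by (auto simp: swap_def)
    then have "card (swap K k n \<inter> {..<x}) \<le> card (insert n (K \<inter> {..<x} - {k}))"
      by (intro card_mono) auto
    also have "\<dots> \<le> Suc (card (K \<inter> {..<x} - {k}))"
      by (rule card_insert_le_m1) auto
    also have "\<dots> = card (K \<inter> {..<x})"
      using True upD[OF up(1)] by (intro card_Suc_Diff1) auto
    finally show ?thesis .
  next
    case False
    then have "swap K k n \<inter> {..<x} = K \<inter> {..<x}"
      using upD[OF up(1)] by (auto simp: swap_def)
    then show ?thesis by simp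
  qed
  with up show ?case by simp
qed simp

text \<open>The counts below each \<open>x \<le> k\<close> are squeezed between equal values, and
  consecutive counts determine membership.\<close>

lemma interval_agree:
  assumes "fle I K" "fle K J" "I \<inter> {..<k} = J \<inter> {..<k}"
  shows "K \<inter> {..<k} = I \<inter> {..<k}"
proof -
  have card: "card (K \<inter> {..<x}) = card (I \<inter> {..<x})" if "x \<le> k" for x
  proof -
    have "I \<inter> {..<x} = J \<inter> {..<x}"
      using arg_cong[OF assms(3), of "\<lambda>A. A \<inter> {..<x}"] that
      by (simp add: Int_assoc Int_absorb1)
    then show ?thesis
      using fle_card_below[OF assms(1), of x] fle_card_below[OF assms(2), of x] by simp
  qed
  have "i \<in> K \<longleftrightarrow> i \<in> I" if "i < k" for i
    using card[of i] card[of "Suc i"] that by (simp add: card_below_Suc split: if_splits)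
  then show ?thesis by auto
qed

lemma fle_first_difference:
  assumes "fle I J" "I \<inter> {..<k} = J \<inter> {..<k}" "k \<in> J"
  shows "k \<in> I"
  using fle_card_below[OF assms(1), of "Suc k"] assms(2,3)
  by (simp add: card_below_Suc split: if_splits)

text \<open>
  Both roots are inverted only after position \<open>a\<close>, which makes them the simple roots of the
  rank two subsystem they span.
\<close>

lemma rank_two_coefficients:
  assumes k: "up K k c" and a: "up K a b" and order: "k < a" "a < c" "c < b"
    and \<beta>: "\<beta> \<in> \<Phi>" "pos \<beta>" "\<beta> = x *\<^sub>R rt K k + y *\<^sub>R rt K a"
  shows "x \<ge> 0 \<and> y \<ge> 0"
proof -
  note k' = upD[OF k] and a' = upD[OF a]
  let ?\<gamma> = "rt K k" and ?\<delta> = "rt K a"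
  let ?p = "\<lambda>z. act (inv (pre K z))"
  have K: "K \<in> Fac" using k' by simp
  have neq: "?\<gamma> \<noteq> ?\<delta>"
    using rt_less_neq[OF K order(3)] k' a' by auto
  have lin: "?p z \<beta> = x *\<^sub>R ?p z ?\<gamma> + y *\<^sub>R ?p z ?\<delta>" for z
    by (simp add: \<beta>(3) act_add act_scale)
  have inj: "?p z u = ?p z v \<Longrightarrow> u = v" for z u v
    by (metis act_inv(2) pre_closed)
  \<comment> \<open>The roots of \<open>k\<close> and \<open>a\<close> reappear at the positions
    \<open>c\<close> and \<open>b\<close> outside \<open>K\<close>. From \<open>k\<close> and from
    \<open>a\<close> one root is simple and the other positive; from \<open>b\<close>, which lies
    after \<open>c\<close>, \<open>?\<gamma>\<close> is negative.\<close>
  have pk: "?p k ?\<gamma> = \<alpha> (Q ! k)" "pos (?p k ?\<delta>)" "?p k ?\<delta> \<in> \<Phi>"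
    using rt_pos_before[OF K, of b k] a' order by (auto simp: rt_pull_back intro!: act_root)
  have pa: "?p a ?\<delta> = \<alpha> (Q ! a)" "pos (?p a ?\<gamma>)" "?p a ?\<gamma> \<in> \<Phi>"
    using rt_pos_before[OF K, of c a] k' order by (auto simp: rt_pull_back intro!: act_root)
  have pb: "?p b ?\<delta> = \<alpha> (Q ! b)" "pos (- ?p b ?\<gamma>)"
    using rt_neg_after[OF K, of c b] k' a' order by (auto simp: rt_pull_back)
  \<comment> \<open>In a reduced word a positive root that has been inverted stays inverted.\<close>
  have inverted_later: "pos (- ?p z' \<beta>)" if later: "\<not> pos (?p z \<beta>)" "z \<le> z'" "z' \<le> m" for z z'
  proof -
    obtain j where "j < z" "j \<notin> K" "rt K j = \<beta>"
      using inversion_before[of \<beta> z K] \<beta>(1,2) later by fastforce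
    then show ?thesis
      using rt_neg_after[OF K, of j z'] later by simp
  qed
  \<comment> \<open>Such a root would already be inverted at \<open>k\<close>, hence negative from
    \<open>a\<close>, and there its negative is a multiple of a simple root minus a positive
    root.\<close>
  have "\<not> (x > 0 \<and> y < 0)"
  proof
    assume xy: "x > 0 \<and> y < 0"
    have "\<not> pos (?p k \<beta>)"
    proof
      assume "pos (?p k \<beta>)"
      then have "pos (x *\<^sub>R \<alpha> (Q ! k) - (- y) *\<^sub>R ?p k ?\<delta>)"
        by (simp add: lin pk)
      then have "?p k ?\<delta> = \<alpha> (Q ! k)"
        using pk xy k' by (intro pos_minus_multiple_simple[where x = x and y = "- y"]) auto
      then show False
        using neq inj[of k ?\<gamma> ?\<delta>] pk by simp
    qed
    then have "pos (- ?p a \<beta>)"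
      using order a' by (intro inverted_later) auto
    then have "pos ((- y) *\<^sub>R \<alpha> (Q ! a) - x *\<^sub>R ?p a ?\<gamma>)"
      by (simp add: lin pa algebra_simps)
    then have "?p a ?\<gamma> = \<alpha> (Q ! a)"
      using pa xy a' by (intro pos_minus_multiple_simple[where x = "- y" and y = x]) auto
    then show False
      using neq inj[of a ?\<gamma> ?\<delta>] pa by simp
  qed
  \<comment> \<open>Such a root would be inverted at \<open>a\<close>, hence negative from
    \<open>b\<close>, where both \<open>- ?\<gamma>\<close> and \<open>?\<delta>\<close> are
    positive.\<close>
  moreover have "\<not> (x < 0 \<and> y > 0)"
  proof
    assume xy: "x < 0 \<and> y > 0"
    have "\<not> pos (?p a \<beta>)"
    proof
      assume "pos (?p a \<beta>)"
      then have "pos (y *\<^sub>R \<alpha> (Q ! a) - (- x) *\<^sub>R ?p a ?\<gamma>)"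
        by (simp add: lin pa add.commute)
      then have "?p a ?\<gamma> = \<alpha> (Q ! a)"
        using pa xy a' by (intro pos_minus_multiple_simple[where x = y and y = "- x"]) auto
      then show False
        using neq inj[of a ?\<gamma> ?\<delta>] pa by simp
    qed
    then have "pos (- ?p b \<beta>)"
      using order a' by (intro inverted_later) auto
    moreover have "pos ((- x) *\<^sub>R (- ?p b ?\<gamma>) + y *\<^sub>R ?p b ?\<delta>)"
      using pb xy a' by (intro pos_combination) auto
    then have "pos (?p b \<beta>)"
      by (simp add: lin)
    ultimately show False
      using pos_not_neg by blast
  qed
  moreover have "\<not> (x \<le> 0 \<and> y \<le> 0)"
  proof
    assume xy: "x \<le> 0 \<and> y \<le> 0"
    have "x \<noteq> 0 \<or> y \<noteq> 0"
      using root_nonzero[OF \<beta>(1)] \<beta>(3) by auto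
    then have "pos ((- x) *\<^sub>R ?\<gamma> + (- y) *\<^sub>R ?\<delta>)"
      using xy k' a' inversion_pos by (intro pos_combination) auto
    then have "pos (- \<beta>)"
      by (simp add: \<beta>(3))
    then show False
      using \<beta>(2) pos_not_neg by blast
  qed
  ultimately show ?thesis by linarith
qed

text \<open>Positive roots of the plane are nonnegative combinations of two inversions, so
  \<open>inv \<rho>\<close> makes them negative as well.\<close>

lemma rank_two_inversions:
  assumes k: "up K k c" and a: "up K a b" and order: "k < a" "a < c" "c < b"
    and \<beta>: "\<beta> \<in> \<Phi>" "\<beta> \<in> span {rt K k, rt K a}"
  shows "\<beta> \<in> inversions \<or> - \<beta> \<in> inversions"
proof -
  have *: "\<beta>' \<in> inversions"
    if \<beta>'_root: "\<beta>' \<in> \<Phi>" "pos \<beta>'" and \<beta>'_span: "\<beta>' \<in> span {rt K k, rt K a}" for \<beta>'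
  proof -
    obtain x y where \<beta>': "\<beta>' = x *\<^sub>R rt K k + y *\<^sub>R rt K a"
      using \<beta>'_span by (auto simp: span_insert span_singleton algebra_simps)
    then have "x \<ge> 0" "y \<ge> 0"
      using rank_two_coefficients[OF k a order \<beta>'_root] by auto
    moreover have "x \<noteq> 0 \<or> y \<noteq> 0"
      using root_nonzero[OF \<beta>'_root(1)] \<beta>' by auto
    ultimately have "pos (x *\<^sub>R - act (inv \<rho>) (rt K k) + y *\<^sub>R - act (inv \<rho>) (rt K a))"
      using upD(9)[OF k] upD(9)[OF a] by (intro pos_combination) (auto simp: inversions_def)
    then have "pos (- act (inv \<rho>) \<beta>')"
      using \<rho>_closed by (simp add: \<beta>' act_add act_scale)
    with \<beta>'_root show ?thesis
      by (simp add: inversions_def)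
  qed
  show ?thesis
    using root_pos_or_neg[OF \<beta>(1)] *[of \<beta>] *[of "- \<beta>"] \<beta> by (auto intro: root_minus span_neg)
qed

section \<open>Sinks of links\<close>

text \<open>Let \<open>y\<close> be the first difference, say in \<open>G\<close>. Below
  \<open>y\<close> the facets agree, so \<open>y\<close> and \<open>c\<close> have the same opposite
  roots in \<open>H\<close>; but both lie outside \<open>H\<close>, where roots are inversions and
  hence positive.\<close>

lemma sink_unique:
  assumes "G \<in> Fac" "H \<in> Fac"
    and G: "\<And>y. y \<in> G - H \<Longrightarrow> \<exists>c < y. c \<notin> G \<and> rt G c = - rt G y"
    and H: "\<And>y. y \<in> H - G \<Longrightarrow> \<exists>c < y. c \<notin> H \<and> rt H c = - rt H y"
  shows "G = H"
proof -
  have absurd: False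
    if F: "G \<in> Fac" "H \<in> Fac" and y: "y \<in> G" "y \<notin> H" "\<And>z. z < y \<Longrightarrow> z \<in> G \<longleftrightarrow> z \<in> H"
      and c: "c < y" "c \<notin> G" "rt G c = - rt G y" for G H y c
  proof -
    have "rt G y = rt H y" "rt G c = rt H c"
      using y(3) c(1) by (auto intro!: rt_cong)
    moreover have "pos (rt H y)" "pos (rt H c)"
      using rt_inversion[OF F(2)] inversion_pos facet_less[OF F(1) y(1)] y c by auto
    ultimately show False
      using c(3) pos_not_neg by metis
  qed
  have "z \<in> G \<longleftrightarrow> z \<in> H" for z
  proof (induction z rule: less_induct)
    case (less z)
    show ?case
      using absurd[of G H z] absurd[of H G z] G[of z] H[of z] less assms(1,2) by blast
  qed
  then show ?thesis by auto
qed

text \<open>Flip upwards outside \<open>F\<close> as long as possible. The reflections used preserve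
  \<open>P\<close>, and when the process stops every root outside \<open>F\<close> is the negative
  of an inversion, which occurs at an earlier position.\<close>

lemma ascend_to_sink:
  assumes "G \<in> Fac" "F \<subseteq> G" "\<And>x. x \<in> G - F \<Longrightarrow> rt G x \<in> P"
    and P: "subspace P" "\<And>\<beta>. \<lbrakk>\<beta> \<in> \<Phi>; \<beta> \<in> P\<rbrakk> \<Longrightarrow> \<beta> \<in> inversions \<or> - \<beta> \<in> inversions"
  shows "\<exists>H. fle G H \<and> F \<subseteq> H \<and> (\<forall>y \<in> H - F. \<exists>c < y. c \<notin> H \<and> rt H c = - rt H y)"
  using assms(1-3)
\<comment> \<open>An increasing flip raises the sum of the positions, which is bounded by the sum of
  all positions.\<close>
proof (induction "\<Sum>{..<m} - \<Sum>G" arbitrary: G rule: less_induct)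
  case less
  show ?case
  proof (cases "\<exists>y \<in> G - F. rt G y \<in> inversions")
    case True
    then obtain y n where y: "y \<in> G - F" "up G y n"
      using ex_up less.prems(1) by blast
    note u = upD[OF y(2)]
    let ?G = "swap G y n"
    have refl: "reflection_along (rt G y) v \<in> P" if "v \<in> P" for v
      using that less.prems(3)[OF y(1)] P(1)
      by (auto simp: reflection_along_def intro!: subspace_diff subspace_scale)
    have "\<exists>H. fle ?G H \<and> F \<subseteq> H \<and> (\<forall>y \<in> H - F. \<exists>c < y. c \<notin> H \<and> rt H c = - rt H y)"
    proof (rule less.hyps)
      have "\<Sum>G < \<Sum>?G"
        using y(2) by (intro increasing_flip_sum_less[of W S Q \<rho>]) (auto simp: increasing_flip_iff)
      moreover have "\<Sum>?G \<le> \<Sum>{..<m}"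
        using u(10) by (intro sum_mono2) (auto simp: facet_iff)
      ultimately show "\<Sum>{..<m} - \<Sum>?G < \<Sum>{..<m} - \<Sum>G"
        by linarith
      show "F \<subseteq> ?G"
        using less.prems(2) y(1) by (auto simp: swap_def)
      show "rt ?G x \<in> P" if "x \<in> ?G - F" for x
      proof (cases "x = n")
        case True
        then show ?thesis
          using rt_swap_ends(2)[OF y(2)] less.prems(3)[OF y(1)] P(1) by (simp add: subspace_neg)
      next
        case False
        then have "x \<in> G - F"
          using that by (auto simp: swap_def)
        then have "rt G x \<in> P" "x < m"
          using less.prems(1,3) facet_less by auto
        then show ?thesis
          using rt_swap[OF y(2)] refl by simp
      qed
    qed (rule u(10))
    then show ?thesis
      using fle_trans[OF fle_up[OF y(2)]] by blast
  next
    case False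
    have "\<exists>c < y. c \<notin> G \<and> rt G c = - rt G y" if "y \<in> G - F" for y
    proof -
      have "- rt G y \<in> inversions"
        using False P(2)[of "rt G y"] that less.prems facet_less by auto
      then obtain c where "c < m" "c \<notin> G" "rt G c = - rt G y"
        using inversion_rt less.prems(1) by blast
      moreover from this have "c < y"
        using rt_eq_minus_imp_greater[of G y c] that less.prems(1) by auto
      ultimately show ?thesis by blast
    qed
    then show ?thesis
      using less.prems fle_refl by blast
  qed
qed

end

section \<open>Consequences of double root freeness\<close>

locale drf_subword_complex = subword_complex +
  assumes drf: "double_root_free W S act \<alpha> Q \<rho>"
begin

lemma flippable_roots_inj:
  assumes "K \<in> Fac" "i \<in> K" "j \<in> K" "rt K i = rt K j"
    and "rt K i \<in> inversions \<or> - rt K i \<in> inversions"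
  shows "i = j"
  using drf assms flippableI[of K i] flippableI[of K j] unfolding double_root_free_def by auto

text \<open>
  The facets obtained from \<open>K\<close> and \<open>swap K a b\<close> by flipping \<open>k\<close> differ by a single flip unless the
  reflection moves the root at \<open>k\<close>. In that case the link of \<open>K - {k, a}\<close> is a cycle, and
  \<open>swap (swap K a b) k c'\<close> is its sink.
\<close>

lemma flip_mono:
  assumes a: "up K a b" and k: "up K k c" and "k < a"
  obtains c' where "up (swap K a b) k c'" "fle (swap K k c) (swap (swap K a b) k c')"
proof -
  note a' = upD[OF a] and k' = upD[OF k]
  let ?K = "swap K a b" and ?L = "swap K k c"
  have K: "K \<in> Fac" by (rule a'(1))
  \<comment> \<open>Both positions are flippable; distinct roots also make the targets
    \<open>c\<close> and \<open>b\<close> distinct.\<close>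
  have neq: "rt K k \<noteq> rt K a"
    using flippable_roots_inj[of K k a] a' k' \<open>k < a\<close> by auto
  then have cb: "c \<noteq> b" "c \<noteq> a"
    using a' k' by auto
  have rtk: "rt ?K k = rt K k"
    using rt_swap[OF a, of k] k' \<open>k < a\<close> by simp
  obtain c' where c': "up ?K k c'"
    using ex_up[of ?K k] a'(10) k' \<open>k < a\<close> rtk by (auto simp: swap_def)
  note c'' = upD[OF c']
  have "fle ?L (swap ?K k c')"
  proof (cases "a < c \<and> c < b")
    \<comment> \<open>The flip of \<open>a\<close> leaves the root at \<open>c\<close> alone, so the
      two flips commute and \<open>swap ?L a b\<close> is the facet wanted.\<close>
    case False
    then have c: "c < a \<or> b < c"
      using cb by linarith
    have "up ?K k c"
      unfolding up_def using a' k' c'' cb c rtk rt_swap[OF a, of c] by (auto simp: swap_def)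
    then have "c' = c"
      using c' up_unique by blast
    have "up ?L a b"
      unfolding up_def using a' k' cb c \<open>k < a\<close> rt_swap[OF k, of a] rt_swap[OF k, of b]
      by (auto simp: swap_def)
    moreover have "swap ?L a b = swap ?K k c"
      using a' k' cb \<open>k < a\<close> by (auto simp: swap_def)
    ultimately show ?thesis
      using fle_up \<open>c' = c\<close> by metis
  next
    case True
    let ?P = "span {rt K k, rt K a}" and ?F = "K - {k, a}"
    let ?L' = "swap ?K k c'"
    \<comment> \<open>Flips outside \<open>?F\<close> use only roots of the plane \<open>?P\<close>,
      all of which are inversions up to sign.\<close>
    have "\<exists>H. fle ?L H \<and> ?F \<subseteq> H \<and> (\<forall>y \<in> H - ?F. \<exists>c < y. c \<notin> H \<and> rt H c = - rt H y)"
    proof (rule ascend_to_sink[where P = ?P])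
      show "rt ?L x \<in> ?P" if "x \<in> ?L - ?F" for x
      proof -
        have "x = a \<or> x = c"
          using that by (auto simp: swap_def)
        moreover have "rt ?L a = reflection_along (rt K k) (rt K a)"
          using rt_swap[OF k, of a] a' True \<open>k < a\<close> by simp
        ultimately show ?thesis
          using rt_swap_ends(2)[OF k]
          by (auto simp: reflection_along_def intro!: span_diff span_scale span_neg intro: span_base)
      qed
    qed (use k' \<open>k < a\<close> True rank_two_inversions[OF k a] in \<open>auto simp: swap_def\<close>)
    then obtain H where H: "fle ?L H" "?F \<subseteq> H"
      "\<And>y. y \<in> H - ?F \<Longrightarrow> \<exists>c < y. c \<notin> H \<and> rt H c = - rt H y"
      by blast
    \<comment> \<open>Beyond \<open>b\<close> no root was changed, so there \<open>c'\<close> would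
      have to be \<open>c\<close>. The inequality ensures that flipping \<open>k\<close> keeps the
      root at \<open>b\<close>.\<close>
    have "c' < b"
    proof (rule ccontr)
      assume "\<not> c' < b"
      moreover have "c' \<noteq> b"
        using c'' by (auto simp: swap_def)
      ultimately have "b < c'" by simp
      then have "c' \<notin> K" "rt K c' = rt K k"
        using c'' rt_swap[OF a, of c'] rtk a' by (auto simp: swap_def)
      then have "c' = c"
        using rt_inj[OF K, of c' c] k' c'' by simp
      with \<open>b < c'\<close> True show False by simp
    qed
    have "H = ?L'"
    proof (rule sink_unique)
      show "H \<in> Fac" "?L' \<in> Fac"
        using H(1) fle_Fac c'' by auto
      have F: "?F \<subseteq> ?L'"
        by (auto simp: swap_def)
      with H(3) show "\<exists>c < y. c \<notin> H \<and> rt H c = - rt H y" if "y \<in> H - ?L'" for y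
        using that by blast
      show "\<exists>c < y. c \<notin> ?L' \<and> rt ?L' c = - rt ?L' y" if "y \<in> ?L' - H" for y
      proof -
        have "y = c' \<or> y = b"
          using that H(2) by (auto simp: swap_def)
        moreover have "rt ?L' c' = - rt K k"
          using rt_swap_ends(2)[OF c'] rtk by simp
        moreover have "rt ?L' b = - rt K a"
          using rt_swap[OF c', of b] rt_swap_ends(2)[OF a] \<open>c' < b\<close> a' by simp
        ultimately have "- rt ?L' y \<in> inversions"
          using a' k' by auto
        then obtain z where "z < m" "z \<notin> ?L'" "rt ?L' z = - rt ?L' y"
          using inversion_rt c''(10) by blast
        moreover from this have "z < y"
          using rt_eq_minus_imp_greater[of ?L' y z] that c''(10) by auto
        ultimately show ?thesis by blast
      qed
    qed
    with H(1) show ?thesis by simp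
  qed
  with c' that show thesis by blast
qed

text \<open>Follow a path from \<open>K\<close> to \<open>J\<close>. Its first edge either flips
  \<open>k\<close>, where the target is unique, or flips a later position; then
  \<open>flip_mono\<close> compares the flips of \<open>k\<close> before and after it.\<close>

lemma flip_below:
  assumes "fle K J" "up K k n" "k \<notin> J" "K \<inter> {..<k} = J \<inter> {..<k}"
  shows "fle (swap K k n) J"
  using assms(1,2,4)
proof (induction arbitrary: n rule: fle_induct)
  case refl
  with assms(3) upD show ?case by blast
next
  case (up K a b)
  note u = upD[OF up(1)] and k = upD[OF up(4)]
  have agree: "swap K a b \<inter> {..<k} = K \<inter> {..<k}"
    using interval_agree[OF fle_up[OF up(1)] up(2) up(5)] .
  show ?case
  proof (cases "a = k")
    case True
    with up show ?thesis using up_unique by blast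
  next
    case False
    moreover have "a \<notin> swap K a b"
      using u by (simp add: swap_def)
    then have "\<not> a < k"
      using agree u(2) by blast
    ultimately have "k < a" by simp
    then obtain c' where "up (swap K a b) k c'" "fle (swap K k n) (swap (swap K a b) k c')"
      using flip_mono[OF up(1) up(4)] by blast
    then show ?thesis
      using up.IH[of c'] agree up(5) fle_trans by simp
  qed
qed

text \<open>In the common target both new positions carry the negative of the root at
  \<open>k\<close>, so double root freeness identifies them.\<close>

lemma up_source_unique:
  assumes "up K k n" "up K' k n'" "swap K k n = swap K' k n'"
  shows "K = K'"
proof -
  note u = upD[OF assms(1)] and u' = upD[OF assms(2)]
  let ?J = "swap K k n"
  have J: "rt ?J n = - rt ?J k" "rt ?J n' = - rt ?J k"
    using rt_swap_ends[OF assms(1)] rt_swap_ends[OF assms(2)] assms(3) by simp_all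
  moreover have "rt ?J k \<in> inversions"
    using rt_swap_ends(1)[OF assms(1)] u by simp
  moreover have "n \<in> swap K k n" "n' \<in> swap K' k n'"
    by (simp_all add: swap_def)
  then have "n \<in> ?J" "n' \<in> ?J"
    by (simp_all add: assms(3))
  ultimately have "n = n'"
    using flippable_roots_inj[of ?J n n'] u(10) by simp
  have "insert n (K - {k}) - {n} = K - {k}" "insert n' (K' - {k}) - {n'} = K' - {k}"
    using u(5) u'(5) by auto
  then have "K - {k} = K' - {k}"
    using assms(3) \<open>n = n'\<close> unfolding swap_def by metis
  then show ?thesis
    using u(2) u'(2) by (metis insert_Diff)
qed

end

section \<open>Falling paths\<close>

context drf_subword_complex
begin

text \<open>The last argument of \<open>pfall\<close> is a lower bound for the labels of the path.\<close>

inductive pfall :: "nat set \<Rightarrow> nat set \<Rightarrow> nat \<Rightarrow> bool" for I where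
  pfall_refl: "I \<in> Fac \<Longrightarrow> pfall I I b"
| pfall_step: "\<lbrakk>pfall I K k; up K k n; b \<le> k\<rbrakk> \<Longrightarrow> pfall I (swap K k n) b"

lemma pfall_fle: "pfall I J b \<Longrightarrow> fle I J"
  by (induction rule: pfall.induct) (auto intro: fle_refl fle_trans fle_up)

lemma pfall_weaken: "\<lbrakk>pfall I J b; b' \<le> b\<rbrakk> \<Longrightarrow> pfall I J b'"
  by (erule pfall.cases) (auto intro: pfall.intros)

lemma swap_agree: "\<lbrakk>up K k n; b \<le> k\<rbrakk> \<Longrightarrow> swap K k n \<inter> {..<b} = K \<inter> {..<b}"
  using upD(7) by (fastforce simp: swap_def)

lemma pfall_agree: "pfall I J b \<Longrightarrow> J \<inter> {..<b} = I \<inter> {..<b}"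
proof (induction rule: pfall.induct)
  case (pfall_step K k n b)
  have "K \<inter> {..<k} \<inter> {..<b} = I \<inter> {..<k} \<inter> {..<b}"
    using pfall_step by simp
  then show ?case
    using swap_agree[OF pfall_step(2,3)] pfall_step(3) by (simp add: Int_assoc Int_absorb1)
qed simp

text \<open>The last label is the smallest, and it is not \<open>k\<close> because its flip would
  have removed \<open>k\<close>.\<close>

lemma pfall_Suc: "\<lbrakk>pfall I K k; k \<in> K\<rbrakk> \<Longrightarrow> pfall I K (Suc k)"
proof (erule pfall.cases)
  fix b K' l n
  assume "k \<in> K" "k = b" "K = swap K' l n" "pfall I K' l" "up K' l n" "b \<le> l"
  moreover from this have "l \<noteq> k"
    using upD[of K' l n] by (auto simp: swap_def)
  ultimately show ?thesis
    by (auto intro!: pfall.intros)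
qed (auto intro: pfall.intros)

lemma pfall_last_label:
  assumes "pfall I K k" "k \<in> K"
  shows "K \<inter> {..<Suc k} = I \<inter> {..<Suc k}" "k \<in> I"
proof -
  show "K \<inter> {..<Suc k} = I \<inter> {..<Suc k}"
    using pfall_Suc[OF assms] by (rule pfall_agree)
  with assms(2) show "k \<in> I"
    by blast
qed

text \<open>The last and smallest label belongs to \<open>I\<close> but not to \<open>J\<close>, so
  it cannot lie where the two agree.\<close>

lemma pfall_refine:
  assumes "pfall I J b" "J \<inter> {..<c} = I \<inter> {..<c}"
  shows "pfall I J c"
  using assms(1)
proof cases
  case pfall_refl
  then show ?thesis by (auto intro: pfall.intros)
next
  case (pfall_step K l n)
  have "l \<in> K" "l \<notin> J"
    using pfall_step(1) upD[OF pfall_step(3)] by (auto simp: swap_def)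
  moreover have "l \<in> I"
    using pfall_last_label[OF pfall_step(2)] \<open>l \<in> K\<close> by simp
  ultimately have "\<not> l < c"
    using assms(2) by blast
  with pfall_step show ?thesis
    by (auto intro: pfall.intros)
qed

text \<open>
  The facet reached from \<open>I\<close> by a falling path with label set \<open>X\<close> is characterised as the sink of
  the link of \<open>I - X\<close>: every position outside \<open>I - X\<close> can be flipped back.
\<close>

definition sink_above :: "nat set \<Rightarrow> nat set \<Rightarrow> nat set \<Rightarrow> nat \<Rightarrow> bool" where
  "sink_above I X J b \<longleftrightarrow> J \<in> Fac \<and> J \<inter> {..<b} = I \<inter> {..<b} \<and> I - X \<subseteq> J \<and>
    (\<forall>y \<in> J. b \<le> y \<longrightarrow> y \<in> I - X \<or> (\<exists>c. b \<le> c \<and> c < y \<and> c \<notin> J \<and> rt J c = - rt J y))"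

lemma sink_aboveD:
  assumes "sink_above I X J b"
  shows "J \<in> Fac" "J \<inter> {..<b} = I \<inter> {..<b}" "I - X \<subseteq> J"
    and "\<And>y. \<lbrakk>y \<in> J; b \<le> y; y \<notin> I - X\<rbrakk> \<Longrightarrow> \<exists>c. b \<le> c \<and> c < y \<and> c \<notin> J \<and> rt J c = - rt J y"
  using assms by (auto simp: sink_above_def)

text \<open>Between \<open>b\<close> and \<open>k\<close> the facet agrees with \<open>I\<close> and
  \<open>X\<close> has no elements, so no new condition arises.\<close>

lemma sink_above_lower:
  assumes "sink_above I X J k" "b \<le> k" "X \<inter> {b..<k} = {}"
  shows "sink_above I X J b"
proof -
  note D = sink_aboveD[OF assms(1)]
  have agree: "z \<in> J \<longleftrightarrow> z \<in> I" if "z < k" for z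
    using D(2) that by blast
  have "\<exists>c. b \<le> c \<and> c < y \<and> c \<notin> J \<and> rt J c = - rt J y"
    if "y \<in> J" "b \<le> y" "y \<notin> I - X" for y
  proof -
    have "k \<le> y"
      using agree[of y] that assms(3) by (cases "y < k") auto
    then show ?thesis
      using D(4)[of y] that assms(2) by (metis le_trans)
  qed
  moreover have "J \<inter> {..<b} = I \<inter> {..<b}"
    using agree assms(2) by auto
  ultimately show ?thesis
    using D by (auto simp: sink_above_def)
qed

text \<open>The new position \<open>n\<close> flips back to \<open>b\<close>. For the other
  positions a witness for flipping back is kept or replaced, according to whether their root is
  reflected.\<close>

lemma sink_above_step:
  assumes "sink_above I X J (Suc b)" "b \<in> X" "up J b n"
  shows "sink_above I X (swap J b n) b"
proof -
  note D = sink_aboveD[OF assms(1)] and u = upD[OF assms(3)]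
  let ?J = "swap J b n"
  have "J \<inter> {..<b} = I \<inter> {..<b}"
    using D(2) by (auto simp: lessThan_Suc)
  then have "?J \<inter> {..<b} = I \<inter> {..<b}"
    using swap_agree[OF assms(3), of b] by simp
  moreover have "I - X \<subseteq> ?J"
    using D(3) assms(2) by (auto simp: swap_def)
  moreover have "\<exists>c. b \<le> c \<and> c < y \<and> c \<notin> ?J \<and> rt ?J c = - rt ?J y"
    if y: "y \<in> ?J" "b \<le> y" "y \<notin> I - X" for y
  proof (cases "y = n")
    case True
    then show ?thesis
      using rt_swap_ends[OF assms(3)] u by (intro exI[of _ b]) (auto simp: swap_def)
  next
    case False
    then have "y \<in> J" "y \<noteq> b"
      using y(1) u by (auto simp: swap_def)
    then have "y < m"
      using D(1) facet_less by blast
    obtain c where c: "Suc b \<le> c" "c < y" "c \<notin> J" "rt J c = - rt J y"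
      using D(4)[of y] y \<open>y \<in> J\<close> \<open>y \<noteq> b\<close> by auto
    show ?thesis
    proof (cases "y < n")
      case True
      \<comment> \<open>Both \<open>c\<close> and \<open>y\<close> lie strictly between
        \<open>b\<close> and \<open>n\<close>, so their opposite roots are reflected
        together.\<close>
      have "rt ?J c = reflection_along (rt J b) (rt J c)"
        "rt ?J y = reflection_along (rt J b) (rt J y)"
        using rt_swap[OF assms(3), of c] rt_swap[OF assms(3), of y] c True \<open>y < m\<close> by auto
      then have "rt ?J c = - rt ?J y"
        using c(4) by (simp add: reflection_along_def)
      moreover have "c \<notin> ?J"
        using c True by (auto simp: swap_def)
      ultimately show ?thesis
        using c by (intro exI[of _ c]) auto
    next
      case False
      with \<open>y \<noteq> n\<close> have rty: "rt ?J y = rt J y"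
        using rt_swap[OF assms(3), of y] \<open>y < m\<close> by simp
      have "rt J c \<in> inversions"
        by (rule rt_inversion[OF D(1)]) (use c \<open>y < m\<close> in auto)
      \<comment> \<open>The root at \<open>y\<close> is unchanged but the one at \<open>c\<close>
        may move, so the witness is the position that now carries the old root of
        \<open>c\<close>.\<close>
      then obtain c' where c': "c' < m" "c' \<notin> ?J" "rt ?J c' = rt J c"
        using inversion_rt u(10) by blast
      have "c' < y"
        using rt_eq_minus_imp_greater[OF u(10) y(1) c'(1,2)] c'(3) c(4) rty by simp
      moreover have "b \<le> c'"
      proof (rule ccontr)
        assume "\<not> b \<le> c'"
        then have "c' \<notin> J" "rt J c' = rt J c"
          using c' rt_swap[OF assms(3), of c'] by (auto simp: swap_def)
        then have "c' = c"
          using rt_inj[OF D(1)] c c'(1) \<open>y < m\<close> by simp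
        with \<open>\<not> b \<le> c'\<close> c show False by simp
      qed
      ultimately show ?thesis
        using c'(2,3) c(4) rty by (intro exI[of _ c']) auto
    qed
  qed
  ultimately show ?thesis
    using u(10) by (auto simp: sink_above_def)
qed

text \<open>Scan the positions from right to left and flip those in \<open>X\<close>. When
  \<open>b\<close> is reached the facet still agrees with \<open>I\<close> below \<open>b\<close>,
  so the root at \<open>b\<close> is still an inversion.\<close>

lemma sink_above_exists:
  assumes "I \<in> Fac" "X \<subseteq> {i \<in> I. rt I i \<in> inversions}" "b \<le> m"
  shows "\<exists>J. sink_above I X J b"
  using assms(3)
proof (induction b rule: inc_induct)
  case base
  have "sink_above I X I m"
    using assms(1) facet_less by (fastforce simp: sink_above_def)
  then show ?case by blast
next
  case (step b)
  then obtain J where J: "sink_above I X J (Suc b)" by blast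
  note D = sink_aboveD[OF J]
  show ?case
  proof (cases "b \<in> X")
    case True
    then have "b \<in> I" "rt I b \<in> inversions"
      using assms(2) by auto
    then have "b \<in> J"
      using D(2) by blast
    moreover have "J \<inter> {..<b} = I \<inter> {..<b}"
      using D(2) by (auto simp: lessThan_Suc)
    then have "rt J b = rt I b"
      by (rule rt_cong)
    ultimately obtain n where "up J b n"
      using ex_up D(1) \<open>rt I b \<in> inversions\<close> by metis
    then show ?thesis
      using sink_above_step[OF J True] by blast
  next
    case False
    then have "sink_above I X J b"
      by (intro sink_above_lower[OF J]) auto
    then show ?thesis by blast
  qed
qed

lemma sink_above_insert:
  assumes "sink_above I X K k" "k \<in> K" "K \<inter> {..<Suc k} = I \<inter> {..<Suc k}"
  shows "sink_above I (insert k X) K (Suc k)"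
proof -
  note D = sink_aboveD[OF assms(1)]
  have "\<exists>c. Suc k \<le> c \<and> c < y \<and> c \<notin> K \<and> rt K c = - rt K y"
    if "y \<in> K" "Suc k \<le> y" "y \<notin> I - insert k X" for y
  proof -
    have "\<exists>c. k \<le> c \<and> c < y \<and> c \<notin> K \<and> rt K c = - rt K y"
      using that by (intro D(4)) auto
    then obtain c where "k \<le> c" "c < y" "c \<notin> K" "rt K c = - rt K y" by blast
    moreover from this have "c \<noteq> k"
      using assms(2) by blast
    ultimately show ?thesis
      by (intro exI[of _ c]) auto
  qed
  then show ?thesis
    using D assms by (auto simp: sink_above_def)
qed

text \<open>The set \<open>X\<close> is the set of labels of the path.\<close>

lemma pfall_sink_above:
  assumes "pfall I J b"
  shows "\<exists>X. X \<subseteq> {i \<in> I. rt I i \<in> inversions \<and> b \<le> i} \<and> sink_above I X J b"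
  using assms
proof (induction rule: pfall.induct)
  case (pfall_refl b)
  then have "sink_above I {} I b"
    by (auto simp: sink_above_def)
  then show ?case by blast
next
  case (pfall_step K k n b)
  note u = upD[OF pfall_step(2)]
  obtain X where X: "X \<subseteq> {i \<in> I. rt I i \<in> inversions \<and> k \<le> i}" "sink_above I X K k"
    using pfall_step.IH by blast
  note last = pfall_last_label[OF pfall_step(1) u(2)]
  have "sink_above I (insert k X) (swap K k n) k"
    using sink_above_insert[OF X(2) u(2) last(1)] pfall_step(2) by (intro sink_above_step) auto
  then have "sink_above I (insert k X) (swap K k n) b"
    by (rule sink_above_lower) (use pfall_step(3) X(1) in auto)
  moreover have "rt I k = rt K k"
    using pfall_agree[OF pfall_step(1)] by (intro rt_cong) simp
  then have "insert k X \<subseteq> {i \<in> I. rt I i \<in> inversions \<and> b \<le> i}"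
    using X(1) last(2) u(9) pfall_step(3) by auto
  ultimately show ?case by blast
qed

text \<open>
  If the flip restored a position \<open>n\<close> of \<open>I\<close>, then omitting \<open>n\<close> from the labels of the path would
  lead to the same sink, and the two last flips would share their target.
\<close>

lemma falling_flip_new_position:
  assumes w: "pfall I w (Suc k)" and I: "I \<in> Fac" and up: "up w k n"
  shows "n \<notin> I"
proof
  assume "n \<in> I"
  note u = upD[OF up]
  have "w \<inter> {..<Suc k} = I \<inter> {..<Suc k}"
    using w by (rule pfall_agree)
  then have "k \<in> I" and "w \<inter> {..<k} = I \<inter> {..<k}"
    using u(2) by (auto simp: lessThan_Suc)
  then have rtI: "rt w k = rt I k"
    using rt_cong by blast
  obtain X where X: "X \<subseteq> {i \<in> I. rt I i \<in> inversions \<and> Suc k \<le> i}" "sink_above I X w (Suc k)"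
    using pfall_sink_above[OF w] by blast
  \<comment> \<open>A position of \<open>I\<close> missing from \<open>w\<close> must have been a
    label.\<close>
  have "n \<in> X"
    using sink_aboveD(3)[OF X(2)] u(5) \<open>n \<in> I\<close> by blast
  let ?X = "X - {n}"
  obtain w' where w': "sink_above I ?X w' (Suc k)"
    using sink_above_exists[OF I, of ?X "Suc k"] X(1) u(3) by auto
  note D = sink_aboveD[OF w']
  have "k \<in> w'" "w' \<inter> {..<k} = I \<inter> {..<k}"
    using D(2) \<open>k \<in> I\<close> by (blast, auto simp: lessThan_Suc)
  then have "rt w' k \<in> inversions"
    using rt_cong[of w' k I] rtI u(9) by simp
  then obtain n' where up': "up w' k n'"
    using ex_up D(1) \<open>k \<in> w'\<close> by blast
  \<comment> \<open>Above \<open>k\<close> it makes no difference whether \<open>k\<close> counts as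
    a label.\<close>
  have insert: "sink_above I (insert k Y) v (Suc k)" if "sink_above I Y v (Suc k)" for Y v
    using that by (auto simp: sink_above_def)
  let ?G = "swap w k n" and ?H = "swap w' k n'"
  have G: "sink_above I (insert k X) ?G k"
    using insert[OF X(2)] up by (intro sink_above_step) auto
  have H: "sink_above I (insert k ?X) ?H k"
    using insert[OF w'] up' by (intro sink_above_step) auto
  note DG = sink_aboveD[OF G] and DH = sink_aboveD[OF H]
  have below: "y \<in> ?G \<longleftrightarrow> y \<in> ?H" if "y < k" for y
    using DG(2) DH(2) that by blast
  \<comment> \<open>The label sets differ only in \<open>n\<close>, which belongs to
    \<open>?G\<close>, so every position in just one of the two facets can be flipped back.\<close>
  have "?G = ?H"
  proof (rule sink_unique)
    show "\<exists>c < y. c \<notin> ?G \<and> rt ?G c = - rt ?G y" if "y \<in> ?G - ?H" for y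
      using that below[of y] DH(3) DG(4)[of y] by (cases "y < k") auto
    have "n \<in> ?G"
      by (simp add: swap_def)
    then show "\<exists>c < y. c \<notin> ?H \<and> rt ?H c = - rt ?H y" if "y \<in> ?H - ?G" for y
      using that below[of y] DG(3) DH(4)[of y] by (cases "y < k"; cases "y = n") auto
  qed (fact DG DH)+
  then have "w = w'"
    using up_source_unique[OF up up'] by blast
  then show False
    using D(3) u(5) \<open>n \<in> I\<close> by blast
qed

section \<open>The sign-reversing involution\<close>

definition fall_sign :: "nat set \<Rightarrow> nat set \<Rightarrow> int" where
  "fall_sign I J = (if pfall I J 0 then (-1) ^ card (J - I) else 0)"

lemma fall_sign_self: "I \<in> Fac \<Longrightarrow> fall_sign I I = 1"
  by (simp add: fall_sign_def pfall_refl)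

text \<open>Flipping the first position that distinguishes \<open>I\<close> from \<open>J\<close> is a sign-reversing involution.\<close>

lemma fall_sign_sum:
  assumes "fle I J" "I \<noteq> J"
  shows "(\<Sum>w \<in> {w \<in> Fac. fle I w \<and> fle w J}. fall_sign I w) = 0"
proof -
  define k where "k = (LEAST x. (x \<in> I) \<noteq> (x \<in> J))"
  have "\<exists>x. (x \<in> I) \<noteq> (x \<in> J)"
    using assms(2) by auto
  then have kdiff: "(k \<in> I) \<noteq> (k \<in> J)"
    unfolding k_def by (rule LeastI_ex)
  have "x \<in> I \<longleftrightarrow> x \<in> J" if "x < k" for x
    using that not_less_Least unfolding k_def by blast
  then have agree: "I \<inter> {..<k} = J \<inter> {..<k}"
    by auto
  have k: "k \<in> I" "k \<notin> J"
    using fle_first_difference[OF assms(1) agree] kdiff by auto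
  have Fac: "I \<in> Fac" "J \<in> Fac"
    using fle_Fac assms(1) by auto
  define Z where "Z = {w \<in> Fac. fle I w \<and> fle w J \<and> pfall I w 0}"
  have Z_agree: "w \<inter> {..<k} = I \<inter> {..<k}" if "w \<in> Z" for w
    using interval_agree[OF _ _ agree] that by (simp add: Z_def)
  define ZA where "ZA = {w \<in> Z. k \<in> w}"
  define ZB where "ZB = {w \<in> Z. k \<notin> w}"
  define f where "f w = swap w k (SOME n. up w k n)" for w
  have f: "\<exists>n. up w k n \<and> f w = swap w k n" if "w \<in> ZA" for w
  proof -
    \<comment> \<open>As \<open>k\<close> is outside \<open>J\<close>, its root in \<open>J\<close>
      is an inversion; agreement below \<open>k\<close> transfers this to \<open>w\<close>.\<close>
    have "rt w k = rt J k"
      using Z_agree[of w] that agree by (intro rt_cong) (simp add: ZA_def)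
    then have "rt w k \<in> inversions"
      using rt_inversion[OF Fac(2)] k facet_less[OF Fac(1)] by simp
    then have "\<exists>n. up w k n"
      using ex_up[of w k] that by (auto simp: ZA_def Z_def)
    then show ?thesis
      unfolding f_def by (metis someI_ex)
  qed
  have ZA_pfall: "pfall I w (Suc k)" if "w \<in> ZA" for w
  proof (rule pfall_refine)
    show "w \<inter> {..<Suc k} = I \<inter> {..<Suc k}"
      using Z_agree[of w] that k(1) by (auto simp: ZA_def lessThan_Suc)
  qed (use that in \<open>auto simp: ZA_def Z_def\<close>)
  have "inj_on f ZA"
    using f up_source_unique by (metis inj_onI)
  moreover have "f ` ZA = ZB"
  proof (intro equalityI subsetI)
    fix v assume "v \<in> f ` ZA"
    then obtain w n where w: "w \<in> ZA" "up w k n" "v = swap w k n"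
      using f by (metis imageE)
    note u = upD[OF w(2)]
    have "fle v J"
      unfolding w(3) using w(1,2) k(2) Z_agree[of w] agree
      by (intro flip_below) (auto simp: ZA_def Z_def)
    moreover have "fle I v"
      unfolding w(3) using w(1) fle_trans fle_up[OF w(2)] by (auto simp: ZA_def Z_def)
    moreover have "pfall I v 0"
      unfolding w(3) using pfall_weaken[OF ZA_pfall[OF w(1)], of k] w(2) by (auto intro: pfall_step)
    moreover have "k \<notin> v"
      using u w(3) by (auto simp: swap_def)
    ultimately show "v \<in> ZB"
      using fle_Fac by (auto simp: ZB_def Z_def)
  next
    fix v assume v: "v \<in> ZB"
    then have "pfall I v 0" "k \<notin> v" "v \<in> Z"
      by (auto simp: ZB_def Z_def)
    \<comment> \<open>The path is not trivial since \<open>k\<close> is in \<open>I\<close>. Its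
      last label cannot precede \<open>k\<close>, where \<open>v\<close> agrees with
      \<open>I\<close>, nor exceed \<open>k\<close>, since then no flip would remove
      \<open>k\<close>.\<close>
    from this(1) obtain K l n where K: "v = swap K l n" "pfall I K l" "up K l n"
      by cases (use k \<open>k \<notin> v\<close> in auto)
    note u = upD[OF K(3)]
    have "l \<in> I" "l \<notin> v"
      using pfall_last_label[OF K(2) u(2)] u(8) K(1) by (auto simp: swap_def)
    then have "\<not> l < k"
      using Z_agree[OF \<open>v \<in> Z\<close>] by blast
    moreover have "\<not> k < l"
    proof
      assume "k < l"
      then have "k \<in> K"
        using pfall_agree[OF K(2)] k(1) by blast
      with \<open>k < l\<close> show False
        using K(1) \<open>k \<notin> v\<close> by (auto simp: swap_def)
    qed
    ultimately have "l = k" by simp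
    have "K \<in> ZA"
      using K u v fle_trans[OF fle_up[OF K(3)]] pfall_fle[OF K(2)] pfall_weaken[OF K(2), of 0] \<open>l = k\<close>
      by (auto simp: ZA_def ZB_def Z_def)
    moreover have "f K = v"
      using f[OF \<open>K \<in> ZA\<close>] K \<open>l = k\<close> up_unique by blast
    ultimately show "v \<in> f ` ZA" by blast
  qed
  ultimately have bij: "bij_betw f ZA ZB"
    by (simp add: bij_betw_def)
  \<comment> \<open>The flip removes an element of \<open>I\<close> and adds one outside
    \<open>I\<close>, so \<open>w - I\<close> gains exactly one element.\<close>
  have sign: "(-1) ^ card (f w - I) = - ((-1) ^ card (w - I) :: int)" if "w \<in> ZA" for w
  proof -
    obtain n where n: "up w k n" "f w = swap w k n"
      using f \<open>w \<in> ZA\<close> by blast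
    have "n \<notin> I"
      using falling_flip_new_position[OF ZA_pfall[OF that] Fac(1) n(1)] .
    then have "f w - I = insert n (w - I)" "n \<notin> w - I"
      using n k(1) upD[OF n(1)] by (auto simp: swap_def)
    moreover have "finite (w - I)"
      using upD(1)[OF n(1)] by (auto simp: facet_iff intro: finite_subset)
    ultimately show ?thesis by simp
  qed
  have fin: "finite Fac"
    by (rule finite_facets)
  have "(\<Sum>w \<in> {w \<in> Fac. fle I w \<and> fle w J}. fall_sign I w) = (\<Sum>w \<in> Z. (-1) ^ card (w - I))"
  proof -
    have "Z = {w \<in> {w \<in> Fac. fle I w \<and> fle w J}. pfall I w 0}"
      by (auto simp: Z_def)
    moreover have "finite {w \<in> Fac. fle I w \<and> fle w J}"
      using fin by simp
    ultimately show ?thesis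
      unfolding fall_sign_def by (simp only: sum.inter_filter)
  qed
  also have "Z = ZA \<union> ZB"
    by (auto simp: ZA_def ZB_def)
  also have "(\<Sum>w \<in> ZA \<union> ZB. (-1) ^ card (w - I))
      = (\<Sum>w \<in> ZA. (-1) ^ card (w - I)) + (\<Sum>w \<in> ZB. (-1) ^ card (w - I) :: int)"
    using fin by (intro sum.union_disjoint) (auto simp: ZA_def ZB_def Z_def)
  also have "(\<Sum>w \<in> ZB. (-1) ^ card (w - I) :: int) = (\<Sum>w \<in> ZA. (-1) ^ card (f w - I))"
    by (rule sum.reindex_bij_betw[OF bij, symmetric])
  also have "\<dots> = - (\<Sum>w \<in> ZA. (-1) ^ card (w - I))"
    by (simp add: sign sum_negf)
  finally show ?thesis by simp
qed

end

section \<open>Moebius functions and reversal\<close>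

lemma poset_moebius_self:
  "\<lbrakk>finite P; partial_order_on P r; u \<in> P\<rbrakk> \<Longrightarrow> poset_moebius P r u u = 1"
  by (subst poset_moebius.simps) (auto simp: partial_order_on_def preorder_on_def refl_on_def)

lemma poset_moebius_sum:
  assumes "finite P" "partial_order_on P r" "(u, v) \<in> r"
  shows "(\<Sum>w \<in> {w \<in> P. (u, w) \<in> r \<and> (w, v) \<in> r}. poset_moebius P r u w) = (if u = v then 1 else 0)"
proof -
  have refl: "(v, v) \<in> r" "u \<in> P" "v \<in> P" and anti: "antisym r"
    using assms(2,3) by (auto simp: partial_order_on_def preorder_on_def refl_on_def)
  show ?thesis
  proof (cases "u = v")
    case True
    then have "{w \<in> P. (u, w) \<in> r \<and> (w, v) \<in> r} = {u}"
      using refl anti by (auto dest: antisymD)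
    then show ?thesis
      using True poset_moebius_self[OF assms(1,2) refl(2)] by simp
  next
    case False
    have "{w \<in> P. (u, w) \<in> r \<and> (w, v) \<in> r}
        = insert v {w \<in> P. (u, w) \<in> r \<and> (w, v) \<in> r \<and> w \<noteq> v}"
      using refl assms(3) by auto
    moreover have "poset_moebius P r u v
        = - (\<Sum>w \<in> {w \<in> P. (u, w) \<in> r \<and> (w, v) \<in> r \<and> w \<noteq> v}. poset_moebius P r u w)"
      using assms False by (subst poset_moebius.simps) simp
    ultimately show ?thesis
      using False assms(1) by simp
  qed
qed

text \<open>Sum \<open>poset_moebius P r u w * g x\<close> over all \<open>w\<close> below
  \<open>x\<close> in the interval. Summing over \<open>x\<close> first gives the Moebius value at
  \<open>v\<close>; summing over \<open>w\<close> first gives \<open>g u\<close>.\<close>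

lemma poset_moebius_left_unique:
  fixes g :: "'a \<Rightarrow> int"
  assumes P: "finite P" "partial_order_on P r" and "(u, v) \<in> r"
    and g: "\<And>w. (w, v) \<in> r \<Longrightarrow>
      (\<Sum>x \<in> {x \<in> P. (w, x) \<in> r \<and> (x, v) \<in> r}. g x) = (if w = v then 1 else 0)"
  shows "poset_moebius P r u v = g u"
proof -
  let ?I = "{x \<in> P. (u, x) \<in> r \<and> (x, v) \<in> r}"
  let ?\<mu> = "poset_moebius P r u"
  have refl: "refl_on P r" and tr: "trans r" and sub: "r \<subseteq> P \<times> P"
    using P(2) by (auto simp: partial_order_on_def preorder_on_def)
  have uv: "u \<in> ?I" "v \<in> ?I"
    using refl sub assms(3) by (auto simp: refl_on_def)
  have fin: "finite ?I" using P(1) by simp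
  have "?\<mu> v = (\<Sum>w \<in> ?I. ?\<mu> w * (if w = v then 1 else 0))"
    using uv(2) fin by (simp add: if_distrib sum.delta cong: if_cong)
  also have "\<dots> = (\<Sum>w \<in> ?I. ?\<mu> w * (\<Sum>x \<in> {x \<in> ?I. (w, x) \<in> r}. g x))"
  proof (rule sum.cong[OF HOL.refl])
    fix w assume w: "w \<in> ?I"
    then have "{x \<in> ?I. (w, x) \<in> r} = {x \<in> P. (w, x) \<in> r \<and> (x, v) \<in> r}"
      using tr by (auto dest: transD)
    then show "?\<mu> w * (if w = v then 1 else 0) = ?\<mu> w * (\<Sum>x \<in> {x \<in> ?I. (w, x) \<in> r}. g x)"
      using g[of w] w by simp
  qed
  also have "\<dots> = (\<Sum>w \<in> ?I. \<Sum>x \<in> ?I. if (w, x) \<in> r then ?\<mu> w * g x else 0)"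
    by (simp only: sum_distrib_left sum.inter_filter[OF fin]) (auto intro!: sum.cong)
  also have "\<dots> = (\<Sum>x \<in> ?I. \<Sum>w \<in> ?I. if (w, x) \<in> r then ?\<mu> w * g x else 0)"
    by (rule sum.swap)
  also have "\<dots> = (\<Sum>x \<in> ?I. g x * (\<Sum>w \<in> {w \<in> ?I. (w, x) \<in> r}. ?\<mu> w))"
    by (simp only: sum_distrib_left sum.inter_filter[OF fin]) (auto intro!: sum.cong)
  also have "\<dots> = (\<Sum>x \<in> ?I. g x * (if u = x then 1 else 0))"
  proof (rule sum.cong[OF HOL.refl])
    fix x assume x: "x \<in> ?I"
    then have "{w \<in> ?I. (w, x) \<in> r} = {w \<in> P. (u, w) \<in> r \<and> (w, x) \<in> r}"
      using tr by (auto dest: transD)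
    then show "g x * (\<Sum>w \<in> {w \<in> ?I. (w, x) \<in> r}. ?\<mu> w) = g x * (if u = x then 1 else 0)"
      using poset_moebius_sum[OF P, of u x] x by simp
  qed
  also have "\<dots> = g u"
    using uv(1) fin by (simp add: if_distrib sum.delta cong: if_cong)
  finally show ?thesis .
qed

text \<open>Both functions have the same sum over the interval and agree below its top, by induction
  on the number of elements below \<open>v\<close>.\<close>

lemma poset_moebius_right_unique:
  fixes f :: "'a \<Rightarrow> int"
  assumes P: "finite P" "partial_order_on P r"
    and f: "\<And>w. (u, w) \<in> r \<Longrightarrow>
      (\<Sum>x \<in> {x \<in> P. (u, x) \<in> r \<and> (x, w) \<in> r}. f x) = (if u = w then 1 else 0)"
    and "(u, v) \<in> r"
  shows "poset_moebius P r u v = f v"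
proof -
  have tr: "trans r" and anti: "antisym r" and sub: "r \<subseteq> P \<times> P" and refl: "refl_on P r"
    using P(2) by (auto simp: partial_order_on_def preorder_on_def)
  let ?\<mu> = "poset_moebius P r u"
  show ?thesis
    using assms(4)
  proof (induction "card {x \<in> P. (x, v) \<in> r}" arbitrary: v rule: less_induct)
    case less
    let ?I = "{x \<in> P. (u, x) \<in> r \<and> (x, v) \<in> r}"
    have v: "v \<in> ?I" and fin: "finite ?I"
      using less.prems sub refl P(1) by (auto simp: refl_on_def)
    have "?\<mu> x = f x" if "x \<in> ?I - {v}" for x
    proof (rule less.hyps)
      have "{y \<in> P. (y, x) \<in> r} \<subset> {y \<in> P. (y, v) \<in> r}"
        using that v tr anti by (auto dest: transD antisymD)
      then show "card {y \<in> P. (y, x) \<in> r} < card {y \<in> P. (y, v) \<in> r}"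
        using P(1) by (intro psubset_card_mono) auto
    qed (use that in auto)
    then have "sum ?\<mu> (?I - {v}) = sum f (?I - {v})"
      by (rule sum.cong[OF HOL.refl])
    moreover have "sum ?\<mu> ?I = sum f ?I"
      using poset_moebius_sum[OF P less.prems] f[OF less.prems] by simp
    ultimately show ?case
      using sum.remove[OF fin v, of ?\<mu>] sum.remove[OF fin v, of f] by simp
  qed
qed

section \<open>Label sequences of paths\<close>

definition labels :: "(nat set \<Rightarrow> nat set \<Rightarrow> nat) \<Rightarrow> nat set list \<Rightarrow> nat list" where
  "labels l xs = map2 l (butlast xs) (tl xs)"

lemma falling_labels: "falling l xs \<longleftrightarrow> sorted_wrt (\<ge>) (labels l xs)"
  by (simp add: falling_def labels_def)

lemma labels_Cons: "xs \<noteq> [] \<Longrightarrow> labels l (x # xs) = l x (hd xs) # labels l xs"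
  by (cases xs) (auto simp: labels_def)

lemma labels_snoc: "xs \<noteq> [] \<Longrightarrow> labels l (xs @ [x]) = labels l xs @ [l (last xs) x]"
proof (induction xs)
  case (Cons y xs)
  then show ?case
    by (cases "xs = []") (simp_all add: labels_Cons, simp add: labels_def)
qed simp

lemma labels_map_rev:
  "\<lbrakk>successively R xs; \<And>A B. R A B \<Longrightarrow> l' (f B) (f A) = h (l A B)\<rbrakk>
    \<Longrightarrow> labels l' (map f (rev xs)) = map h (rev (labels l xs))"
proof (induction xs)
  case Nil
  then show ?case by (simp add: labels_def)
next
  case (Cons x xs)
  show ?case
  proof (cases "xs = []")
    case True
    then show ?thesis by (simp add: labels_def)
  next
    case False
    then have "R x (hd xs)" "successively R xs"
      using Cons.prems(1) by (cases xs; simp)+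
    with False Cons show ?thesis
      by (simp add: labels_snoc labels_Cons last_map last_rev)
  qed
qed

context subword_complex
begin

lemma flip_labels:
  assumes "up K k n"
  shows "p_label K (swap K k n) = k" "n_label K (swap K k n) = n"
proof -
  note u = upD[OF assms]
  have eq: "K - {k} = swap K k n - {n}" "k \<notin> swap K k n" "n \<in> swap K k n"
    using u by (auto simp: swap_def)
  show "p_label K (swap K k n) = k"
    unfolding p_label_def
  proof (rule the_equality)
    fix i assume "i \<in> K \<and> (\<exists>j \<in> swap K k n. K - {i} = swap K k n - {j})"
    then show "i = k"
      using eq(2) u(2) by blast
  qed (use eq u in blast)
  show "n_label K (swap K k n) = n"
    unfolding n_label_def
  proof (rule the_equality)
    fix j assume "j \<in> swap K k n \<and> (\<exists>i \<in> K. K - {i} = swap K k n - {j})"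
    then show "j = n"
      using eq(3) u(5) by blast
  qed (use eq u in blast)
qed

end

context drf_subword_complex
begin

text \<open>The bound \<open>b\<close> serves the induction on the last edge: the labels before it
  must be at least its label.\<close>

lemma pfall_iff_labels:
  assumes "I \<in> Fac"
  shows "pfall I J b \<longleftrightarrow>
    (\<exists>xs. flip_path W S Q \<rho> I J xs \<and> falling p_label xs \<and> (\<forall>l \<in> set (labels p_label xs). b \<le> l))"
    (is "_ \<longleftrightarrow> (\<exists>xs. ?P J b xs)")
proof
  assume "pfall I J b"
  then show "\<exists>xs. ?P J b xs"
  proof (induction rule: pfall.induct)
    case (pfall_refl b)
    then have "?P I b [I]"
      by (simp add: flip_path_def falling_labels labels_def)
    then show ?case by blast
  next
    case (pfall_step K k n b)
    then obtain xs where xs: "?P K k xs" by blast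
    then have "xs \<noteq> []" "last xs = K" by (auto simp: flip_path_def)
    then have lab: "labels p_label (xs @ [swap K k n]) = labels p_label xs @ [k]"
      using flip_labels[OF pfall_step(2)] by (simp add: labels_snoc)
    have "increasing_flip W S Q \<rho> K (swap K k n)"
      using pfall_step(2) by (auto simp: increasing_flip_iff)
    then have "flip_path W S Q \<rho> I (swap K k n) (xs @ [swap K k n])"
      using xs upD[OF pfall_step(2)] by (auto simp: flip_path_def successively_append_iff)
    moreover have "falling p_label (xs @ [swap K k n])"
      using xs by (auto simp: falling_labels lab sorted_wrt_append)
    ultimately have "?P (swap K k n) b (xs @ [swap K k n])"
      using xs pfall_step(3) by (auto simp: lab)
    then show ?case by blast
  qed
next
  assume "\<exists>xs. ?P J b xs"
  then obtain xs where "?P J b xs" by blast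
  then show "pfall I J b"
  proof (induction xs arbitrary: J b rule: rev_induct)
    case Nil
    then show ?case by (simp add: flip_path_def)
  next
    case (snoc y xs)
    show ?case
    proof (cases "xs = []")
      case True
      then show ?thesis
        using snoc.prems assms by (auto simp: flip_path_def intro: pfall_refl)
    next
      case False
      then have path: "flip_path W S Q \<rho> I (last xs) xs" "increasing_flip W S Q \<rho> (last xs) y" "y = J"
        using snoc.prems by (auto simp: flip_path_def successively_append_iff)
      then obtain k n where up: "up (last xs) k n" "J = swap (last xs) k n"
        by (auto simp: increasing_flip_iff)
      then have lab: "labels p_label (xs @ [J]) = labels p_label xs @ [k]"
        using flip_labels[OF up(1)] False by (simp add: labels_snoc)
      have "pfall I (last xs) k"
        using path snoc.prems by (intro snoc.IH) (auto simp: falling_labels lab sorted_wrt_append)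
      then show ?thesis
        unfolding up(2) using up(1) snoc.prems path(3) by (intro pfall_step) (auto simp: lab)
    qed
  qed
qed

lemma pfall_iff:
  "I \<in> Fac \<Longrightarrow> pfall I J 0 \<longleftrightarrow> (\<exists>xs. flip_path W S Q \<rho> I J xs \<and> falling p_label xs)"
  by (simp add: pfall_iff_labels)

lemma moebius_p:
  assumes "I \<in> Fac" "J \<in> Fac"
  shows "poset_moebius Fac (flip_order W S Q \<rho>) I J = fall_sign I J"
proof (cases "fle I J")
  case True
  show ?thesis
  proof (rule poset_moebius_right_unique[OF finite_facets flip_order_partial_order _ True])
    fix w assume "fle I w"
    moreover have "{x \<in> Fac. fle I x \<and> fle x I} = {I}"
      using fle_antisym fle_refl assms(1) by auto
    ultimately show "(\<Sum>x \<in> {x \<in> Fac. fle I x \<and> fle x w}. fall_sign I x) = (if I = w then 1 else 0)"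
      using fall_sign_sum[of I w] fall_sign_self[OF assms(1)] by auto
  qed
next
  case False
  then show ?thesis
    using pfall_fle by (subst poset_moebius.simps) (auto simp: fall_sign_def)
qed

text \<open>All facets have the same size, because their complements have \<open>len \<rho>\<close>
  elements.\<close>

lemma facet_card_diff:
  assumes "I \<in> Fac" "J \<in> Fac"
  shows "card (I - J) = card (J - I)"
proof -
  have fin: "finite I" "finite J"
    using assms by (auto simp: facet_iff intro: finite_subset)
  have "card A + card ({..<m} - A) = m" if "A \<subseteq> {..<m}" for A
    using that card_Un_disjoint[of A "{..<m} - A"]
    by (auto simp: Un_absorb1 finite_subset)
  then have "card I = card J"
    using assms unfolding facet_iff by (metis add_right_cancel)
  then show ?thesis
    using fin by (simp add: card_Diff_subset_Int Int_commute)
qed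

end

section \<open>Reversal of the word\<close>

definition mirror :: "nat \<Rightarrow> nat set \<Rightarrow> nat set" where
  "mirror n I = (\<lambda>x. n - Suc x) ` I"

text \<open>Subtraction is truncated, so the map is an involution only on \<open>{..<n}\<close>;
  hence the side condition.\<close>

lemma mem_mirror: "I \<subseteq> {..<n} \<Longrightarrow> x \<in> mirror n I \<longleftrightarrow> x < n \<and> n - Suc x \<in> I"
  unfolding mirror_def by (auto simp: image_iff subset_eq Bex_def intro: exI[of _ "n - Suc x"])

lemma mirror_subset: "I \<subseteq> {..<n} \<Longrightarrow> mirror n I \<subseteq> {..<n}"
  by (auto simp: mem_mirror)

lemma mirror_mirror: "I \<subseteq> {..<n} \<Longrightarrow> mirror n (mirror n I) = I"
  by (auto simp: set_eq_iff mem_mirror[OF mirror_subset] mem_mirror subset_eq)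

lemma mirror_diff:
  assumes "I \<subseteq> {..<n}" "J \<subseteq> {..<n}"
  shows "mirror n (I - J) = mirror n I - mirror n J"
proof -
  have "I - J \<subseteq> {..<n}"
    using assms by auto
  then show ?thesis
    using assms by (auto simp: set_eq_iff mem_mirror)
qed

lemma mirror_singleton [simp]: "mirror n {i} = {n - Suc i}"
  by (simp add: mirror_def)

lemma card_mirror:
  assumes "I \<subseteq> {..<n}"
  shows "card (mirror n I) = card I"
proof -
  have "inj_on (\<lambda>x. n - Suc x) {..<n}"
    by (rule inj_onI) (simp add: Suc_le_eq eq_diff_iff)
  then show ?thesis
    unfolding mirror_def using assms by (intro card_image) (rule inj_on_subset)
qed

context subword_complex
begin

lemma facet_subset: "I \<in> Fac \<Longrightarrow> I \<subseteq> {..<m}"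
  by (simp add: facet_iff)

lemma rev_subword_complex: "subword_complex W S act \<Phi> \<alpha> (rev Q) (inv \<rho>)"
  by unfold_locales (use Q_word \<rho>_closed in auto)

text \<open>A prefix of the reversed word is the inverse of the suffix of \<open>Q\<close> starting
  at \<open>m - x\<close>.\<close>

lemma pre_mirror:
  assumes "I \<subseteq> {..<m}" "x \<le> m"
  shows "word_prod W (nths (rev Q) ({..<x} - mirror m I)) = inv (pre I m) \<otimes> pre I (m - x)"
proof -
  interpret R: subword_complex W S act \<Phi> \<alpha> "rev Q" "inv \<rho>"
    by (rule rev_subword_complex)
  have "R.pre (mirror m I) x = inv (pre I m) \<otimes> pre I (m - x)"
    using assms(2)
  proof (induction x)
    case (Suc x)
    define y where "y = m - Suc x"
    then have y: "m - x = Suc y" "y < m" "rev Q ! x = Q ! y" "x \<in> mirror m I \<longleftrightarrow> y \<in> I"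
      using Suc.prems assms(1) by (auto simp: rev_nth mem_mirror)
    show ?case
      using Suc y by (simp add: R.pre_Suc pre_Suc m_assoc S_square flip: y_def)
  qed simp
  then show ?thesis
    by (simp add: R.pre_def)
qed

lemma facet_mirror:
  assumes "I \<in> Fac"
  shows "mirror m I \<in> facets W S (rev Q) (inv \<rho>)"
proof -
  interpret R: subword_complex W S act \<Phi> \<alpha> "rev Q" "inv \<rho>"
    by (rule rev_subword_complex)
  note I = facet_subset[OF assms]
  have "mirror m {..<m} = {..<m}"
    by (auto simp: mem_mirror)
  then have "{..<m} - mirror m I = mirror m ({..<m} - I)"
    using mirror_diff[of "{..<m}" m I] I by simp
  then have "card ({..<m} - mirror m I) = card ({..<m} - I)"
    by (simp add: card_mirror)
  moreover have "R.pre (mirror m I) m = inv \<rho>"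
    using pre_mirror[OF I, of m] assms \<rho>_closed by (simp add: R.pre_def facet_iff)
  ultimately show ?thesis
    using assms mirror_subset[OF I] len_inv[OF \<rho>_closed] by (simp add: R.facet_iff facet_iff)
qed

text \<open>The letter at \<open>k\<close> is omitted because \<open>k\<close> is in
  \<open>I\<close>, so the prefixes up to \<open>k\<close> and \<open>Suc k\<close> coincide and no
  sign appears.\<close>

lemma rt_mirror:
  assumes "I \<in> Fac" "k \<in> I"
  shows "root_function W act \<alpha> (rev Q) (mirror m I) (m - Suc k) = act (inv \<rho>) (rt I k)"
proof -
  have k: "k < m" using assms facet_less by blast
  have "word_prod W (nths (rev Q) ({..<m - Suc k} - mirror m I)) = inv \<rho> \<otimes> pre I (Suc k)"
    using pre_mirror[OF facet_subset[OF assms(1)], of "m - Suc k"] k assms(1)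
    by (simp add: facet_iff)
  then show ?thesis
    using k assms(2) \<rho>_closed
    by (simp add: root_function_def[of _ _ _ "rev Q"] rt_eq pre_Suc act_mult' rev_nth)
qed

lemma exchange_mirror:
  assumes "I \<in> Fac" "J \<in> Fac" "i \<in> I" "j \<in> J" "I - {i} = J - {j}"
  shows "mirror m I - {m - Suc i} = mirror m J - {m - Suc j}"
    "m - Suc i \<in> mirror m I" "m - Suc j \<in> mirror m J"
proof -
  have sub: "I \<subseteq> {..<m}" "J \<subseteq> {..<m}" "{i} \<subseteq> {..<m}" "{j} \<subseteq> {..<m}"
    using assms facet_subset by blast+
  show "mirror m I - {m - Suc i} = mirror m J - {m - Suc j}"
    using mirror_diff[OF sub(1,3)] mirror_diff[OF sub(2,4)] assms(5) by simp
qed (use assms in \<open>auto simp: mirror_def\<close>)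

lemma mirror_inj: "\<lbrakk>I \<in> Fac; J \<in> Fac; mirror m I = mirror m J\<rbrakk> \<Longrightarrow> I = J"
  by (metis facet_subset mirror_mirror)

lemma increasing_flip_mirror:
  assumes "increasing_flip W S Q \<rho> I J"
  shows "increasing_flip W S (rev Q) (inv \<rho>) (mirror m J) (mirror m I)"
proof -
  obtain i j where ij: "I \<in> Fac" "J \<in> Fac" "I \<noteq> J" "i \<in> I" "j \<in> J" "I - {i} = J - {j}" "i < j"
    using assms by (auto simp: increasing_flip_def)
  have "m - Suc j < m - Suc i"
    using ij facet_less[of J j] by auto
  then show ?thesis
    unfolding increasing_flip_def
    using exchange_mirror[OF ij(1,2,4-6)] facet_mirror[OF ij(1)] facet_mirror[OF ij(2)]
      mirror_inj[OF ij(1,2)] ij(3) by metis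
qed

lemma flippable_mirror:
  assumes "I \<in> Fac" "flippable W S Q \<rho> I i"
  shows "flippable W S (rev Q) (inv \<rho>) (mirror m I) (m - Suc i)"
proof -
  obtain J j where J: "i \<in> I" "J \<in> Fac" "J \<noteq> I" "j \<in> J" "I - {i} = J - {j}"
    using assms(2) by (auto simp: flippable_def)
  then show ?thesis
    unfolding flippable_def
    using exchange_mirror[OF assms(1) J(2,1,4,5)] facet_mirror[OF J(2)] mirror_inj[OF J(2) assms(1)]
    by metis
qed

lemma fle_mirror:
  assumes "fle I J"
  shows "(mirror m J, mirror m I) \<in> flip_order W S (rev Q) (inv \<rho>)"
proof -
  interpret R: subword_complex W S act \<Phi> \<alpha> "rev Q" "inv \<rho>"
    by (rule rev_subword_complex)
  have "J \<in> Fac"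
    using assms fle_Fac by blast
  from assms show ?thesis
  proof (induction rule: fle_induct)
    case refl
    show ?case
      using R.fle_refl facet_mirror \<open>J \<in> Fac\<close> by blast
  next
    case (up K k n)
    have "increasing_flip W S (rev Q) (inv \<rho>) (mirror m (swap K k n)) (mirror m K)"
      using up(1) by (intro increasing_flip_mirror) (auto simp: increasing_flip_iff)
    then show ?case
      using up(3) R.fle_trans R.fle_up by (metis R.increasing_flip_iff)
  qed
qed

lemma flip_differences:
  assumes "increasing_flip W S Q \<rho> I J"
  shows "I - J = {p_label I J}" "J - I = {n_label I J}"
proof -
  obtain k n where up: "up I k n" "J = swap I k n"
    using assms by (auto simp: increasing_flip_iff)
  show "I - J = {p_label I J}" "J - I = {n_label I J}"
    using flip_labels[OF up(1)] upD[OF up(1)] up(2) by (auto simp: swap_def)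
qed

lemma labels_mirror:
  assumes "increasing_flip W S Q \<rho> I J"
  shows "p_label (mirror m J) (mirror m I) = m - Suc (n_label I J)"
    and "n_label (mirror m J) (mirror m I) = m - Suc (p_label I J)"
proof -
  interpret R: subword_complex W S act \<Phi> \<alpha> "rev Q" "inv \<rho>"
    by (rule rev_subword_complex)
  have sub: "I \<subseteq> {..<m}" "J \<subseteq> {..<m}"
    using assms facet_subset by (auto simp: increasing_flip_def)
  note R = R.flip_differences[OF increasing_flip_mirror[OF assms]]
  show "p_label (mirror m J) (mirror m I) = m - Suc (n_label I J)"
    using R(1) flip_differences(2)[OF assms] mirror_diff[OF sub(2,1)] by simp
  show "n_label (mirror m J) (mirror m I) = m - Suc (p_label I J)"
    using R(2) flip_differences(1)[OF assms] mirror_diff[OF sub] by simp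
qed

text \<open>Reversing the path and reflecting the positions both reverse the order of labels, so
  falling sequences stay falling while the two labelings are exchanged.\<close>

lemma falling_path_mirror:
  assumes path: "flip_path W S Q \<rho> I J xs"
  defines "ys \<equiv> map (mirror m) (rev xs)"
  shows "flip_path W S (rev Q) (inv \<rho>) (mirror m J) (mirror m I) ys"
    and "falling n_label xs \<Longrightarrow> falling p_label ys"
    and "falling p_label xs \<Longrightarrow> falling n_label ys"
proof -
  have succ: "successively (increasing_flip W S Q \<rho>) xs" and xs: "xs \<noteq> []"
    using path by (auto simp: flip_path_def)
  have "successively (\<lambda>A B. increasing_flip W S (rev Q) (inv \<rho>) (mirror m B) (mirror m A)) xs"
    by (rule successively_mono[OF succ increasing_flip_mirror])
  then show "flip_path W S (rev Q) (inv \<rho>) (mirror m J) (mirror m I) ys"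
    using path facet_mirror unfolding ys_def
    by (auto simp: flip_path_def successively_map successively_rev hd_map last_map hd_rev last_rev
        simp del: rev_map)
  have falling: "falling l' ys"
    if "falling l xs"
      and l': "\<And>A B. increasing_flip W S Q \<rho> A B \<Longrightarrow> l' (mirror m B) (mirror m A) = m - Suc (l A B)"
    for l l'
  proof -
    have "labels l' ys = map (\<lambda>x. m - Suc x) (rev (labels l xs))"
      unfolding ys_def using succ l' by (rule labels_map_rev)
    moreover have "sorted_wrt (\<lambda>x y. m - Suc x \<le> m - Suc y) (labels l xs)"
      using that(1) unfolding falling_labels by (rule sorted_wrt_mono_rel[rotated]) auto
    ultimately show ?thesis
      by (simp add: falling_labels sorted_wrt_map sorted_wrt_rev)
  qed
  show "falling n_label xs \<Longrightarrow> falling p_label ys" "falling p_label xs \<Longrightarrow> falling n_label ys"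
    using falling labels_mirror by blast+
qed

end

section \<open>The formula for the \<open>n\<close>-labeling\<close>

context drf_subword_complex
begin

lemma rev_drf_subword_complex: "drf_subword_complex W S act \<Phi> \<alpha> (rev Q) (inv \<rho>)"
proof -
  interpret R: subword_complex W S act \<Phi> \<alpha> "rev Q" "inv \<rho>"
    by (rule rev_subword_complex)
  have "double_root_free W S act \<alpha> (rev Q) (inv \<rho>)"
    unfolding double_root_free_def
  proof (intro notI, elim bexE exE conjE)
    fix I i j
    assume I: "I \<in> R.Fac" and ij: "i \<noteq> j" "R.rt I i = R.rt I j"
      and flip: "flippable W S (rev Q) (inv \<rho>) I i" "flippable W S (rev Q) (inv \<rho>) I j"
    then have "i \<in> I" "j \<in> I"
      by (auto simp: flippable_def)
    then have "rt (mirror m I) (m - Suc i) = rt (mirror m I) (m - Suc j)"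
      using R.rt_mirror[OF I] ij(2) by simp
    moreover have "m - Suc i \<noteq> m - Suc j"
      using ij(1) R.facet_less[OF I \<open>i \<in> I\<close>] R.facet_less[OF I \<open>j \<in> I\<close>] by simp
    ultimately show False
      using drf R.facet_mirror[OF I] R.flippable_mirror[OF I] flip \<rho>_closed
      unfolding double_root_free_def by auto
  qed
  then show ?thesis
    by unfold_locales
qed

text \<open>The \<open>p\<close>-signs of the reversed word, read on mirrored facets with
  \<open>J\<close> as starting point, sum to zero over each nontrivial interval ending at
  \<open>J\<close>, which is the recursion in the first argument.\<close>

lemma moebius_n:
  assumes "I \<in> Fac" "J \<in> Fac"
  shows "poset_moebius Fac (flip_order W S Q \<rho>) I J
    = (if \<exists>xs. flip_path W S Q \<rho> I J xs \<and> falling n_label xs then (-1) ^ card (J - I) else 0)"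
proof (cases "fle I J")
  case True
  interpret R: drf_subword_complex W S act \<Phi> \<alpha> "rev Q" "inv \<rho>"
    by (rule rev_drf_subword_complex)
  have unmirror: "mirror m A \<in> Fac" "mirror m (mirror m A) = A" if "A \<in> R.Fac" for A
    using R.facet_mirror[OF that] R.facet_subset[OF that] \<rho>_closed by (simp_all add: mirror_mirror)
  have mirror_mirror_facet: "mirror m (mirror m A) = A" if "A \<in> Fac" for A
    using facet_subset[OF that] by (simp add: mirror_mirror)
  have fle_back: "fle (mirror m B) (mirror m A)" if "R.fle A B" for A B
    using R.fle_mirror[OF that] \<rho>_closed by simp
  have "poset_moebius Fac (flip_order W S Q \<rho>) I J = R.fall_sign (mirror m J) (mirror m I)"
  proof (rule poset_moebius_left_unique[OF finite_facets flip_order_partial_order True])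
    fix w assume w: "fle w J"
    then have wFac: "w \<in> Fac" using fle_Fac by blast
    have "bij_betw (mirror m) {x \<in> Fac. fle w x \<and> fle x J}
        {x \<in> R.Fac. R.fle (mirror m J) x \<and> R.fle x (mirror m w)}"
    proof (rule bij_betwI[where g = "mirror m"])
      show "mirror m \<in> {x \<in> Fac. fle w x \<and> fle x J}
          \<rightarrow> {x \<in> R.Fac. R.fle (mirror m J) x \<and> R.fle x (mirror m w)}"
        using facet_mirror fle_mirror by auto
      show "mirror m \<in> {x \<in> R.Fac. R.fle (mirror m J) x \<and> R.fle x (mirror m w)}
          \<rightarrow> {x \<in> Fac. fle w x \<and> fle x J}"
        using fle_back[of "mirror m J"] fle_back[of _ "mirror m w"] unmirror mirror_mirror_facet[OF wFac] mirror_mirror_facet[OF assms(2)]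
        by auto
    qed (use unmirror mirror_mirror_facet in auto)
    then have "(\<Sum>x \<in> {x \<in> Fac. fle w x \<and> fle x J}. R.fall_sign (mirror m J) (mirror m x))
        = (\<Sum>x \<in> {x \<in> R.Fac. R.fle (mirror m J) x \<and> R.fle x (mirror m w)}. R.fall_sign (mirror m J) x)"
      by (rule sum.reindex_bij_betw)
    also have "\<dots> = (if w = J then 1 else 0)"
    proof (cases "w = J")
      case True
      have "{x \<in> R.Fac. R.fle (mirror m J) x \<and> R.fle x (mirror m J)} = {mirror m J}"
        using facet_mirror[OF assms(2)] R.fle_antisym R.fle_refl by blast
      then show ?thesis
        using True R.fall_sign_self facet_mirror[OF assms(2)] by simp
    next
      case False
      then show ?thesis
        using R.fall_sign_sum[OF fle_mirror[OF w]] mirror_inj[OF wFac assms(2)] by auto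
    qed
    finally show "(\<Sum>x \<in> {x \<in> Fac. fle w x \<and> fle x J}. R.fall_sign (mirror m J) (mirror m x))
        = (if w = J then 1 else 0)" .
  qed
  also have "\<dots> = (if R.pfall (mirror m J) (mirror m I) 0 then (-1) ^ card (J - I) else 0)"
  proof -
    \<comment> \<open>Reversal yields the exponent with \<open>I\<close> and \<open>J\<close>
      exchanged; facets of equal size make the two exponents equal.\<close>
    have "card (mirror m I - mirror m J) = card (I - J)"
      using mirror_diff[of I m J] card_mirror[of "I - J" m] assms facet_subset
      by (metis Diff_subset subset_trans)
    then show ?thesis
      using facet_card_diff[OF assms] by (simp add: R.fall_sign_def)
  qed
  also have "R.pfall (mirror m J) (mirror m I) 0
      \<longleftrightarrow> (\<exists>xs. flip_path W S Q \<rho> I J xs \<and> falling n_label xs)"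
    unfolding R.pfall_iff[OF facet_mirror[OF assms(2)]]
  proof
    assume "\<exists>xs. flip_path W S Q \<rho> I J xs \<and> falling n_label xs"
    then show "\<exists>xs. flip_path W S (rev Q) (inv \<rho>) (mirror m J) (mirror m I) xs \<and> falling p_label xs"
      using falling_path_mirror(1,2) by blast
  next
    assume "\<exists>xs. flip_path W S (rev Q) (inv \<rho>) (mirror m J) (mirror m I) xs \<and> falling p_label xs"
    then obtain xs where xs: "flip_path W S (rev Q) (inv \<rho>) (mirror m J) (mirror m I) xs"
      "falling p_label xs" by blast
    show "\<exists>xs. flip_path W S Q \<rho> I J xs \<and> falling n_label xs"
      using R.falling_path_mirror(1)[OF xs(1)] R.falling_path_mirror(3)[OF xs] mirror_mirror_facet assms \<rho>_closed
      by auto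
  qed
  finally show ?thesis .
next
  case False
  then have "\<not> (\<exists>xs. flip_path W S Q \<rho> I J xs \<and> falling n_label xs)"
    by (auto simp: flip_order_def)
  with False show ?thesis
    by (subst poset_moebius.simps) auto
qed

end

theorem corollary5p7:
  fixes W :: "('g, 'b) monoid_scheme"
    and S :: "'g set"
    and act :: "'g \<Rightarrow> 'v::euclidean_space \<Rightarrow> 'v"
    and \<Phi> :: "'v set"
    and \<alpha> :: "'g \<Rightarrow> 'v"
    and Q :: "'g list"
    and \<rho> :: 'g
    and I J :: "nat set"
  assumes "finite_coxeter_system W S act \<Phi> \<alpha>"
    and "Q \<in> lists S"
    and "\<rho> \<in> carrier W"
    and "double_root_free W S act \<alpha> Q \<rho>"
    and "I \<in> facets W S Q \<rho>"
    and "J \<in> facets W S Q \<rho>"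
  shows "(poset_moebius (facets W S Q \<rho>) (flip_order W S Q \<rho>) I J =
      (if \<exists>xs. flip_path W S Q \<rho> I J xs \<and> falling p_label xs
       then (-1) ^ card (J - I) else 0)) \<and>
    (poset_moebius (facets W S Q \<rho>) (flip_order W S Q \<rho>) I J =
      (if \<exists>xs. flip_path W S Q \<rho> I J xs \<and> falling n_label xs
       then (-1) ^ card (J - I) else 0))"
proof -
  interpret drf_subword_complex W S act \<Phi> \<alpha> Q \<rho>
    by (intro drf_subword_complex.intro subword_complex.intro subword_complex_axioms.intro
        drf_subword_complex_axioms.intro) (fact assms)+
  show ?thesis
    using moebius_p[OF assms(5,6)] moebius_n[OF assms(5,6)]
    by (simp add: fall_sign_def pfall_iff[OF assms(5)])
qed

end
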